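(* Let $n\ge 2$ and let $\boldsymbol X=(X_1,\dots,X_n)$ and $\boldsymbol Y=(Y_1,\dots,Y_n)$ be two nonnegative random vectors with joint distribution functions $F$ and $G$, joint densities, and marginal distribution functions $F_1,\dots,F_n$ and $G_1,\dots,G_n$, respectively, that are continuous and have finite expectations. Suppose that $\boldsymbol X$ and $\boldsymbol Y$ have the same copula $C$, and that $C$ is ${\rm MTP}_2$. Then, for $p_1\in(0,1)$ and $(p_2,\dots,p_n)\in(1/2,1)^{n-1}$, with $\boldsymbol p=(p_1,\dots,p_n)$, $X_1\le_{\rm ps}Y_1$ implies that $$\Delta^{\rm R-med}{\rm MCoES}_{\boldsymbol p}[X_1|X_2,\dots,X_n]\le \Delta^{\rm R-med}{\rm MCoES}_{\boldsymbol p}[Y_1|Y_2,\dots,Y_n].$$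
   Context: Value-at-Risk: for a random variable $X$ with distribution function $F_X$ and $p\in(0,1)$, ${\rm VaR}_p[X]=F_X^{-1}(p)=\inf\{x\in\mathbb R: F_X(x)\ge p\}$; the VaR of a conditional random variable is the quantile of its conditional distribution. Multivariate CoVaR and CoES: for $\boldsymbol p=(p_1,\dots,p_n)\in(0,1)^n$, ${\rm MCoVaR}_{\boldsymbol p}[X_1|X_2,\dots,X_n]={\rm VaR}_{p_1}\big[X_1\,\big|\,\bigcap_{j=2}^n\{X_j>{\rm VaR}_{p_j}[X_j]\}\big]$ (the conditioning event is assumed to have positive probability whenever this is written), and ${\rm MCoES}_{\boldsymbol p}[X_1|X_2,\dots,X_n]=\frac1{1-p_1}\int_{p_1}^1{\rm MCoVaR}_{t,p_2,\dots,p_n}[X_1|X_2,\dots,X_n]\,dt$. Write $\boldsymbol p=(p_1,\boldsymbol p_{[-1]})$ with $\boldsymbol p_{[-1]}=(p_2,\dots,p_n)$, and $\frac{\boldsymbol 1}{\boldsymbol 2}=(\frac12,\dots,\frac12)\in\mathbb R^{n-1}$. Median-type ratio-based contribution: for $p_1\in(0,1)$ and $\boldsymbol p_{[-1]}\in(1/2,1)^{n-1}$, $$\Delta^{\rm R-med}{\rm MCoES}_{\boldsymbol p}[X_1|X_2,\dots,X_n]=\frac{{\rm MCoES}_{p_1,\boldsymbol p_{[-1]}}[X_1|X_2,\dots,X_n]-{\rm MCoES}_{p_1,\frac{\boldsymbol 1}{\boldsymbol 2}}[X_1|X_2,\dots,X_n]}{{\rm MCoES}_{p_1,\frac{\boldsymbol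 1}{\boldsymbol 2}}[X_1|X_2,\dots,X_n]},$$ defined when the denominator is nonzero. The same definitions apply to $\boldsymbol Y$. Copula: the copula $C$ of $\boldsymbol X$ is the joint distribution function on $[0,1]^n$ of $(F_1(X_1),\dots,F_n(X_n))$, so $F(x_1,\dots,x_n)=C(F_1(x_1),\dots,F_n(x_n))$; similarly for $\boldsymbol Y$ with $G_i(Y_i)$. ${\rm MTP}_2$ (multivariate totally positive of order 2): a random vector with joint density $f$ is ${\rm MTP}_2$ if $f(\boldsymbol x)f(\boldsymbol y)\le f(\min(\boldsymbol x,\boldsymbol y))\,f(\max(\boldsymbol x,\boldsymbol y))$ for all $\boldsymbol x,\boldsymbol y\in\mathbb R^n$, with min and max taken componentwise. A copula $C$ is ${\rm MTP}_2$ if a random vector with distribution function $C$ is ${\rm MTP}_2$ (i.e. the density of $C$ satisfies this inequality). Expected proportional shortfall order: for nonnegative random variables $X,Y$, $X\le_{\rm ps}Y$ means ${\rm EPS}_p(X)\le{\rm EPS}_p(Y)$ for all $p\in D_X\cap D_Y$, where $D_X=\{p\in(0,1):F_X^{-1}(p)>0\}$, $D_Y=\{p\in(0,1):F_Y^{-1}(p)>0\}$ and ${\rm EPS}_p(X)=\mathbb E\Big[\Big(\frac{X-{\rm VaR}_p[X]}{{\rm VaR}_p[X]}\Big)_+\Big]$, with $x_+=\max(0,x)$. *)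

theory Defs
  imports "HOL-Probability.Probability"
begin

text \<open>
  A random vector of dimension \<open>n\<close> on \<open>M\<close> is a family \<open>X 1, \<dots>, X n\<close> of real functions on
  \<open>space M\<close>. Points of \<open>n\<close>-space are elements of \<open>{1..n} \<rightarrow>\<^sub>E UNIV\<close>, the space of
  \<open>Pi\<^sub>M {1..n} (\<lambda>_. lborel)\<close>.
\<close>

definition rvec :: "nat \<Rightarrow> (nat \<Rightarrow> 'a \<Rightarrow> real) \<Rightarrow> 'a \<Rightarrow> nat \<Rightarrow> real" where
  "rvec n X \<omega> = (\<lambda>i\<in>{1..n}. X i \<omega>)"

definition dist_fun :: "'a measure \<Rightarrow> ('a \<Rightarrow> real) \<Rightarrow> real \<Rightarrow> real" where
  "dist_fun M Z = cdf (distr M borel Z)"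

definition VaR :: "'a measure \<Rightarrow> ('a \<Rightarrow> real) \<Rightarrow> real \<Rightarrow> real" where
  "VaR M Z p = Inf {x. p \<le> dist_fun M Z x}"

definition stress_event :: "nat \<Rightarrow> 'a measure \<Rightarrow> (nat \<Rightarrow> 'a \<Rightarrow> real) \<Rightarrow> (nat \<Rightarrow> real) \<Rightarrow> 'a set" where
  "stress_event n M X p = {\<omega> \<in> space M. \<forall>j\<in>{2..n}. VaR M (X j) (p j) < X j \<omega>}"

text \<open>
  \<open>uniform_measure M A\<close> is the conditional probability measure given \<open>A\<close>; it is meaningful
  when \<open>A\<close> has positive probability.
\<close>

definition MCoVaR :: "nat \<Rightarrow> 'a measure \<Rightarrow> (nat \<Rightarrow> 'a \<Rightarrow> real) \<Rightarrow> (nat \<Rightarrow> real) \<Rightarrow> real" where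
  "MCoVaR n M X p = VaR (uniform_measure M (stress_event n M X p)) (X 1) (p 1)"

definition MCoES :: "nat \<Rightarrow> 'a measure \<Rightarrow> (nat \<Rightarrow> 'a \<Rightarrow> real) \<Rightarrow> (nat \<Rightarrow> real) \<Rightarrow> real" where
  "MCoES n M X p = 1 / (1 - p 1) * (LINT t:{p 1<..<1}|lborel. MCoVaR n M X (p(1 := t)))"

definition median_levels :: "(nat \<Rightarrow> real) \<Rightarrow> nat \<Rightarrow> real" where
  "median_levels p = (\<lambda>_. 1 / 2)(1 := p 1)"

definition Delta_R_med_MCoES ::
    "nat \<Rightarrow> 'a measure \<Rightarrow> (nat \<Rightarrow> 'a \<Rightarrow> real) \<Rightarrow> (nat \<Rightarrow> real) \<Rightarrow> real" where
  "Delta_R_med_MCoES n M X p =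
     (MCoES n M X p - MCoES n M X (median_levels p)) / MCoES n M X (median_levels p)"

definition is_copula_of ::
    "nat \<Rightarrow> 'a measure \<Rightarrow> (nat \<Rightarrow> 'a \<Rightarrow> real) \<Rightarrow> ((nat \<Rightarrow> real) \<Rightarrow> real) \<Rightarrow> bool" where
  "is_copula_of n M X C \<longleftrightarrow>
     (\<forall>u \<in> {1..n} \<rightarrow>\<^sub>E {0..1}.
        C u = measure M {\<omega> \<in> space M. \<forall>i\<in>{1..n}. dist_fun M (X i) (X i \<omega>) \<le> u i})"

text \<open>
  Densities are unique only almost everywhere, so the inequality is required of some version.
\<close>

definition MTP2 :: "nat \<Rightarrow> 'a measure \<Rightarrow> (nat \<Rightarrow> 'a \<Rightarrow> real) \<Rightarrow> bool" where
  "MTP2 n M X \<longleftrightarrow>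
     (\<exists>f :: (nat \<Rightarrow> real) \<Rightarrow> real.
        distributed M (Pi\<^sub>M {1..n} (\<lambda>_. lborel)) (rvec n X) (\<lambda>x. ennreal (f x)) \<and>
        (\<forall>x \<in> {1..n} \<rightarrow>\<^sub>E UNIV. 0 \<le> f x) \<and>
        (\<forall>x \<in> {1..n} \<rightarrow>\<^sub>E UNIV. \<forall>y \<in> {1..n} \<rightarrow>\<^sub>E UNIV.
           f x * f y \<le> f (\<lambda>i\<in>{1..n}. min (x i) (y i)) * f (\<lambda>i\<in>{1..n}. max (x i) (y i))))"

text \<open>
  The random vector with distribution function \<open>C\<close> is taken on its canonical space, with the
  coordinate maps as components; only its law \<open>\<mu>\<close> matters. For a copula \<open>C\<close> the values on the
  unit cube already force \<open>\<mu>\<close> to be concentrated there.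
\<close>

definition MTP2_copula :: "nat \<Rightarrow> ((nat \<Rightarrow> real) \<Rightarrow> real) \<Rightarrow> bool" where
  "MTP2_copula n C \<longleftrightarrow>
     (\<exists>\<mu>. prob_space \<mu> \<and> sets \<mu> = sets (Pi\<^sub>M {1..n} (\<lambda>_. borel)) \<and>
        (\<forall>u \<in> {1..n} \<rightarrow>\<^sub>E {0..1}. measure \<mu> {v \<in> space \<mu>. \<forall>i\<in>{1..n}. v i \<le> u i} = C u) \<and>
        MTP2 n \<mu> (\<lambda>i v. v i))"

definition EPS :: "'a measure \<Rightarrow> ('a \<Rightarrow> real) \<Rightarrow> real \<Rightarrow> real" where
  "EPS M Z p = (LINT \<omega>|M. max 0 ((Z \<omega> - VaR M Z p) / VaR M Z p))"

definition pos_levels :: "'a measure \<Rightarrow> ('a \<Rightarrow> real) \<Rightarrow> real set" where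
  "pos_levels M Z = {p \<in> {0<..<1}. 0 < VaR M Z p}"

text \<open>The order is meant for nonnegative random variables, possibly on different spaces.\<close>

definition ps_le :: "'a measure \<Rightarrow> ('a \<Rightarrow> real) \<Rightarrow> 'b measure \<Rightarrow> ('b \<Rightarrow> real) \<Rightarrow> bool" where
  "ps_le M Z N W \<longleftrightarrow> (\<forall>p \<in> pos_levels M Z \<inter> pos_levels N W. EPS M Z p \<le> EPS N W p)"

end

theory Submission
  imports Defs
begin

text \<open>
  Let \<open>U i = F i (X i)\<close>, so that the law of \<open>U\<close> is the copula, and let \<open>w q\<close> be the density of
  \<open>U 1\<close> restricted to the event \<open>U j > q j\<close> for \<open>j \<ge> 2\<close>. Up to a factor that depends on the copula
  only, the expected shortfall of \<open>X 1\<close> under stress at levels \<open>q\<close> is the integral of the quantile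
  function of \<open>X 1\<close> against \<open>w q\<close> cut off below its own quantile. By the four functions theorem the
  MTP2 property makes each \<open>w q\<close> nondecreasing and the ratio of \<open>w p\<close> to \<open>w (1/2)\<close> nondecreasing.

  The order \<open>ps_le\<close> bounds the logarithmic derivative of the tail integral of the quantile function
  of \<open>X 1\<close> by that of \<open>Y 1\<close>, so the quotient of the two tail integrals is monotone. This suffices for
  the quotient of the integrals of the two quantile functions against a nondecreasing weight to
  increase when the weight is multiplied by a nondecreasing function.
\<close>

section \<open>The four functions theorem\<close>

text \<open>Three points shape the argument. A density is determined only almost everywhere, whereas
  monotonicity and total positivity are pointwise. So one MTP2 version of the copula density is
  fixed, and weights are compared on a set \<open>E\<close> of full measure in (0,1) where the slice
  without stress (all levels -1) equals 1. That constant slice also explains why a single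
  \<open>w q\<close> increases: total positivity between the levels q and -1 loses its second
  factor. The cutoffs are the second point. The quantile of \<open>U 1\<close> under stress moves
  with the levels, and two different indicators could spoil the monotone ratio of the weights. They
  do not, because the higher stress has the larger quantile; this is total positivity again,
  integrated over the two half lines beside the quantile. The third is the link to
  \<open>ps_le\<close>: the integral of the quantile function over (t,1) is the quantile at t times
  EPS + 1 - t. Comparing EPS therefore compares tail integrals divided by quantiles, i.e.
  \<open>b * A \<le> a * B\<close>, the cross-multiplied form of the bound on logarithmic
  derivatives.\<close>

lemma add_le_add_of_mult_le_ennreal:
  fixes a b c d :: ennreal
  assumes ac: "a \<le> c" and bc: "b \<le> c" and abcd: "a * b \<le> c * d"
  shows "a + b \<le> c + d"
proof (cases "c = \<top> \<or> d = \<top> \<or> c = 0")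
  case True
  then show ?thesis using ac bc by auto
next
  case False
  obtain c' d' where c': "c = ennreal c'" "0 \<le> c'" and d': "d = ennreal d'" "0 \<le> d'"
    using False by (metis ennreal_cases infinity_ennreal_def)
  obtain a' b' where a': "a = ennreal a'" "0 \<le> a'" and b': "b = ennreal b'" "0 \<le> b'"
    using ac bc c' by (metis ennreal_cases ennreal_less_top infinity_ennreal_def leD)
  have "c' > 0" using False c' by (metis ennreal_0 order_le_less)
  have le: "a' \<le> c'" "b' \<le> c'" using ac bc a' b' c' by auto
  have "a' * b' \<le> c' * d'"
    using abcd a' b' c' d' by (simp add: ennreal_mult[symmetric])
  \<comment> \<open>Expanding gives \<open>c' * (a' + b') \<le> c' * c' + a' * b'\<close>; the last
    product is at most \<open>c' * d'\<close>, and \<open>c'\<close> cancels.\<close>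
  moreover have "0 \<le> (c' - a') * (c' - b')" using le by simp
  ultimately have "c' * (a' + b') \<le> c' * (c' + d')" by (simp add: algebra_simps)
  then have "a' + b' \<le> c' + d'" using \<open>c' > 0\<close> by simp
  then show ?thesis using a' b' c' d' by (simp flip: ennreal_plus)
qed

text \<open>Twice a product of integrals is the double integral of the product symmetrised in x and
  y. For x \<le> y the two symmetrised terms on the left are each at most
  \<open>f3 y * f4 x\<close>, and their product is at most that of the two terms on the right, by
  the hypothesis on the diagonal at x and at y. This is the situation of the preceding sum
  inequality.\<close>

lemma four_functions_real:
  fixes f1 f2 f3 f4 :: "real \<Rightarrow> ennreal"
  assumes [measurable]: "f1 \<in> borel_measurable lborel" "f2 \<in> borel_measurable lborel"
    "f3 \<in> borel_measurable lborel" "f4 \<in> borel_measurable lborel"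
    and le: "\<And>x y. f1 x * f2 y \<le> f3 (max x y) * f4 (min x y)"
  shows "(\<integral>\<^sup>+x. f1 x \<partial>lborel) * (\<integral>\<^sup>+x. f2 x \<partial>lborel)
    \<le> (\<integral>\<^sup>+x. f3 x \<partial>lborel) * (\<integral>\<^sup>+x. f4 x \<partial>lborel)"
proof -
  have symm: "(\<integral>\<^sup>+x. (\<integral>\<^sup>+y. u x * v y + u y * v x \<partial>lborel) \<partial>lborel)
      = 2 * ((\<integral>\<^sup>+x. u x \<partial>lborel) * (\<integral>\<^sup>+x. v x \<partial>lborel))"
    if [measurable]: "u \<in> borel_measurable lborel" "v \<in> borel_measurable lborel"
    for u v :: "real \<Rightarrow> ennreal"
    by (simp add: nn_integral_add nn_integral_cmult nn_integral_multc mult_2 mult.commute)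
  have pt: "f1 x * f2 y + f1 y * f2 x \<le> f3 x * f4 y + f3 y * f4 x" for x y
  proof -
    have *: "f1 x * f2 y + f1 y * f2 x \<le> f3 y * f4 x + f3 x * f4 y" if "x \<le> y" for x y
    proof (rule add_le_add_of_mult_le_ennreal)
      show "f1 x * f2 y \<le> f3 y * f4 x" "f1 y * f2 x \<le> f3 y * f4 x"
        using le[of x y] le[of y x] that by (auto simp: max_def min_def split: if_splits)
      have "f1 x * f2 x * (f1 y * f2 y) \<le> f3 x * f4 x * (f3 y * f4 y)"
        using mult_mono[OF le[of x x] le[of y y]] by simp
      then show "f1 x * f2 y * (f1 y * f2 x) \<le> f3 y * f4 x * (f3 x * f4 y)"
        by (simp add: mult_ac)
    qed
    show ?thesis using *[of x y] *[of y x] by (cases "x \<le> y") (auto simp: add.commute)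
  qed
  have "2 * ((\<integral>\<^sup>+x. f1 x \<partial>lborel) * (\<integral>\<^sup>+x. f2 x \<partial>lborel))
    \<le> 2 * ((\<integral>\<^sup>+x. f3 x \<partial>lborel) * (\<integral>\<^sup>+x. f4 x \<partial>lborel))"
    by (subst (1 2) symm[symmetric]) (auto intro!: nn_integral_mono pt)
  then show ?thesis by (simp add: ennreal_mult_le_mult_iff)
qed

text \<open>Induction on the index set: with the other coordinates fixed at x and y, the
  one-dimensional theorem in the new coordinate shows that the partial integrals satisfy the
  hypothesis again.\<close>

lemma four_functions_PiM:
  fixes J :: "'i set" and f1 f2 f3 f4 :: "('i \<Rightarrow> real) \<Rightarrow> ennreal"
  assumes "finite J"
    and "f1 \<in> borel_measurable (Pi\<^sub>M J (\<lambda>_. lborel))" "f2 \<in> borel_measurable (Pi\<^sub>M J (\<lambda>_. lborel))"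
      "f3 \<in> borel_measurable (Pi\<^sub>M J (\<lambda>_. lborel))" "f4 \<in> borel_measurable (Pi\<^sub>M J (\<lambda>_. lborel))"
    and "\<And>x y. x \<in> J \<rightarrow>\<^sub>E UNIV \<Longrightarrow> y \<in> J \<rightarrow>\<^sub>E UNIV \<Longrightarrow>
      f1 x * f2 y \<le> f3 (\<lambda>i\<in>J. max (x i) (y i)) * f4 (\<lambda>i\<in>J. min (x i) (y i))"
  shows "(\<integral>\<^sup>+x. f1 x \<partial>Pi\<^sub>M J (\<lambda>_. lborel)) * (\<integral>\<^sup>+x. f2 x \<partial>Pi\<^sub>M J (\<lambda>_. lborel))
    \<le> (\<integral>\<^sup>+x. f3 x \<partial>Pi\<^sub>M J (\<lambda>_. lborel)) * (\<integral>\<^sup>+x. f4 x \<partial>Pi\<^sub>M J (\<lambda>_. lborel))"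
  using assms
proof (induction J arbitrary: f1 f2 f3 f4 rule: finite_induct)
  case empty
  interpret product_sigma_finite "\<lambda>_::'i. lborel :: real measure" ..
  show ?case
    using empty(5)[of "\<lambda>_. undefined" "\<lambda>_. undefined"]
    by (simp add: nn_integral_empty restrict_def)
next
  case (insert i J)
  interpret product_sigma_finite "\<lambda>_::'i. lborel :: real measure" ..
  note [measurable] = insert.prems(1-4)
  have int: "(\<integral>\<^sup>+x. f x \<partial>Pi\<^sub>M (insert i J) (\<lambda>_. lborel))
      = (\<integral>\<^sup>+x. (\<integral>\<^sup>+s. f (x(i := s)) \<partial>lborel) \<partial>Pi\<^sub>M J (\<lambda>_. lborel))"
    if "f \<in> borel_measurable (Pi\<^sub>M (insert i J) (\<lambda>_. lborel))" for f :: "('i \<Rightarrow> real) \<Rightarrow> ennreal"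
    using insert.hyps that by (intro product_nn_integral_insert)
  have meas: "(\<lambda>x. \<integral>\<^sup>+s. f (x(i := s)) \<partial>lborel) \<in> borel_measurable (Pi\<^sub>M J (\<lambda>_. lborel))"
    if [measurable]: "f \<in> borel_measurable (Pi\<^sub>M (insert i J) (\<lambda>_. lborel))"
    for f :: "('i \<Rightarrow> real) \<Rightarrow> ennreal"
    by measurable
  have meas1: "(\<lambda>s. f (x(i := s))) \<in> borel_measurable lborel"
    if [measurable]: "f \<in> borel_measurable (Pi\<^sub>M (insert i J) (\<lambda>_. lborel))"
    and x: "x \<in> J \<rightarrow>\<^sub>E UNIV"
    for f :: "('i \<Rightarrow> real) \<Rightarrow> ennreal" and x
  proof -
    have "(\<lambda>s. x(i := s)) \<in> measurable lborel (Pi\<^sub>M (insert i J) (\<lambda>_. lborel))"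
      using measurable_component_update[of x J "\<lambda>_. lborel" i] x insert.hyps
      by (auto simp: space_PiM)
    then show ?thesis by measurable
  qed
  show ?case
    unfolding int[OF insert.prems(1)] int[OF insert.prems(2)]
      int[OF insert.prems(3)] int[OF insert.prems(4)]
  proof (rule insert.IH)
    fix x y :: "'i \<Rightarrow> real"
    assume x: "x \<in> J \<rightarrow>\<^sub>E UNIV" and y: "y \<in> J \<rightarrow>\<^sub>E UNIV"
    let ?M = "\<lambda>i\<in>J. max (x i) (y i)" and ?m = "\<lambda>i\<in>J. min (x i) (y i)"
    show "(\<integral>\<^sup>+s. f1 (x(i := s)) \<partial>lborel) * (\<integral>\<^sup>+s. f2 (y(i := s)) \<partial>lborel)
      \<le> (\<integral>\<^sup>+s. f3 (?M(i := s)) \<partial>lborel) * (\<integral>\<^sup>+s. f4 (?m(i := s)) \<partial>lborel)"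
    proof (rule four_functions_real)
      fix s t :: real
      have "f1 (x(i := s)) * f2 (y(i := t))
          \<le> f3 (\<lambda>j\<in>insert i J. max ((x(i := s)) j) ((y(i := t)) j))
            * f4 (\<lambda>j\<in>insert i J. min ((x(i := s)) j) ((y(i := t)) j))"
        using x y by (intro insert.prems(5)) (auto simp: PiE_iff extensional_def)
      also have "(\<lambda>j\<in>insert i J. max ((x(i := s)) j) ((y(i := t)) j)) = ?M(i := max s t)"
        using insert.hyps by (auto simp: fun_eq_iff)
      also have "(\<lambda>j\<in>insert i J. min ((x(i := s)) j) ((y(i := t)) j)) = ?m(i := min s t)"
        using insert.hyps by (auto simp: fun_eq_iff)
      finally show "f1 (x(i := s)) * f2 (y(i := t)) \<le> f3 (?M(i := max s t)) * f4 (?m(i := min s t))" .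
    qed (rule meas1; use x y insert.prems(1-4) in \<open>auto simp: PiE_iff extensional_def\<close>)+
  qed (rule meas insert.prems(1-4))+
qed

section \<open>Integrals against monotone weights\<close>

lemma layer_cake_ennreal:
  "(\<integral>\<^sup>+z. indicator {z. 0 \<le> z \<and> ennreal z < m} z \<partial>lborel) = m"
proof (cases m)
  case (real c)
  have "{z. 0 \<le> z \<and> ennreal z < m} = {0..<c}"
    using real by (auto simp: ennreal_less_iff)
  then show ?thesis using real by simp
next
  case top
  have "{z. 0 \<le> z \<and> ennreal z < m} = {0::real..}" using top by (auto simp: ennreal_less_top)
  moreover have "emeasure lborel {0::real..} = \<top>"
  proof (rule ccontr)
    assume "emeasure lborel {0::real..} \<noteq> \<top>"
    then obtain c where c: "emeasure lborel {0::real..} = ennreal c" "0 \<le> c"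
      by (cases "emeasure lborel {0::real..}") auto
    have "emeasure lborel {0..c + 1} \<le> emeasure lborel {0::real..}"
      by (intro emeasure_mono) auto
    then show False using c by simp
  qed
  ultimately show ?thesis using top by simp
qed

text \<open>By Tonelli the weight \<open>m\<close> is a superposition of indicators of its
  superlevel sets, so a comparison on every such set suffices. For monotone \<open>m\<close> these
  are upper sets, which reduces weighted integrals to tails.\<close>

lemma nn_integral_mult_mono_layers:
  fixes g h m :: "'a \<Rightarrow> ennreal"
  assumes "sigma_finite_measure M"
    and [measurable]: "g \<in> borel_measurable M" "h \<in> borel_measurable M" "m \<in> borel_measurable M"
    and le: "\<And>z. 0 \<le> z \<Longrightarrow> (\<integral>\<^sup>+u. h u * indicator {u. ennreal z < m u} u \<partial>M)
      \<le> (\<integral>\<^sup>+u. g u * indicator {u. ennreal z < m u} u \<partial>M)"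
  shows "(\<integral>\<^sup>+u. h u * m u \<partial>M) \<le> (\<integral>\<^sup>+u. g u * m u \<partial>M)"
proof -
  interpret sigma_finite_measure M by fact
  interpret pair_sigma_finite M "lborel :: real measure" ..
  have eq: "(\<integral>\<^sup>+u. f u * m u \<partial>M)
      = (\<integral>\<^sup>+z. indicator {0..} z * (\<integral>\<^sup>+u. f u * indicator {u. ennreal z < m u} u \<partial>M) \<partial>lborel)"
    if [measurable]: "f \<in> borel_measurable M" for f
  proof -
    have "(\<integral>\<^sup>+u. f u * m u \<partial>M)
        = (\<integral>\<^sup>+u. (\<integral>\<^sup>+z. f u * indicator {z. 0 \<le> z \<and> ennreal z < m u} z \<partial>lborel) \<partial>M)"
      by (subst nn_integral_cmult) (auto simp: layer_cake_ennreal)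
    also have "\<dots> = (\<integral>\<^sup>+u. (\<integral>\<^sup>+z. indicator {0..} z * (f u * indicator {u. ennreal z < m u} u) \<partial>lborel) \<partial>M)"
      by (intro nn_integral_cong) (auto split: split_indicator)
    also have "\<dots> = (\<integral>\<^sup>+z. (\<integral>\<^sup>+u. indicator {0..} z * (f u * indicator {u. ennreal z < m u} u) \<partial>M) \<partial>lborel)"
      by (rule Fubini'[symmetric]) measurable
    also have "\<dots> = (\<integral>\<^sup>+z. indicator {0..} z * (\<integral>\<^sup>+u. f u * indicator {u. ennreal z < m u} u \<partial>M) \<partial>lborel)"
      by (intro nn_integral_cong nn_integral_cmult) measurable
    finally show ?thesis .
  qed
  show ?thesis unfolding eq[OF assms(2)] eq[OF assms(3)]
    by (intro nn_integral_mono) (auto split: split_indicator intro: le)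
qed

text \<open>
  The bound on \<open>b\<close> says that the logarithmic derivative of \<open>B / A\<close> is nonnegative. Since \<open>a\<close>
  and \<open>b\<close> may jump, the derivative is replaced by a uniform partition of \<open>[s, t]\<close>, along which
  the multiplicative errors telescope to a factor that tends to \<open>1\<close>.
\<close>

lemma ratio_mono_of_logderiv_le:
  fixes a b A B :: "real \<Rightarrow> real"
  assumes "s \<le> t"
    and a_mono: "\<And>x y. s \<le> x \<Longrightarrow> x \<le> y \<Longrightarrow> y \<le> t \<Longrightarrow> a x \<le> a y"
    and a0: "\<And>x. s \<le> x \<Longrightarrow> x \<le> t \<Longrightarrow> 0 \<le> a x"
    and A0: "\<And>x. s \<le> x \<Longrightarrow> x \<le> t \<Longrightarrow> 0 < A x"
    and B0: "\<And>x. s \<le> x \<Longrightarrow> x \<le> t \<Longrightarrow> 0 \<le> B x"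
    and A_diff: "\<And>x y. s \<le> x \<Longrightarrow> x \<le> y \<Longrightarrow> y \<le> t \<Longrightarrow> a x * (y - x) \<le> A x - A y"
    and B_diff: "\<And>x y. s \<le> x \<Longrightarrow> x \<le> y \<Longrightarrow> y \<le> t \<Longrightarrow> B x - B y \<le> b y * (y - x)"
    and bA: "\<And>x. s \<le> x \<Longrightarrow> x \<le> t \<Longrightarrow> b x * A x \<le> a x * B x"
  shows "B s * A t \<le> B t * A s"
proof -
  define r where "r x = B x / A x" for x
  \<comment> \<open>The drop of \<open>B\<close> is bounded by \<open>b\<close> at the right end,
    that of \<open>A\<close> by \<open>a\<close> at the left end; the mismatch costs the increment
    of \<open>a\<close>. On cells of length d the exponents add up to
    \<open>(a t - a s) * d / A t\<close>, where \<open>A t\<close>, the least value of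
    \<open>A\<close>, serves all cells at once.\<close>
  have step: "r x \<le> r y * exp ((a y - a x) * ((y - x) / A t))" if xy: "s \<le> x" "x \<le> y" "y \<le> t" for x y
  proof -
    define d where "d = y - x"
    have d0: "0 \<le> d" using xy by (simp add: d_def)
    have pos: "0 < A x" "0 < A y" "0 \<le> B x" "0 \<le> B y" "0 \<le> a x" "0 \<le> a y" "a x \<le> a y" "0 < A t"
      using xy A0 B0 a0 a_mono by auto
    have AtAy: "A t \<le> A y"
    proof -
      have "0 \<le> a y * (t - y)" using xy pos by simp
      then show ?thesis using A_diff[of y t] xy by simp
    qed
    have b_y: "b y \<le> a y * r y" using bA[of y] xy pos by (simp add: r_def field_simps)
    have "B x \<le> B y + b y * d" using B_diff[of x y] xy by (simp add: d_def)
    also have "\<dots> \<le> B y + a y * r y * d" using b_y d0 by (simp add: mult_right_mono)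
    also have "\<dots> = r y * (A y + a y * d)" using pos by (simp add: r_def field_simps)
    finally have Bx: "B x \<le> r y * (A y + a y * d)" .
    have Ax: "A y + a x * d \<le> A x" using A_diff[of x y] xy by (simp add: d_def)
    have ry: "0 \<le> r y" using pos by (simp add: r_def)
    have "A y + a y * d \<le> A x + (a y - a x) * d" using Ax by (simp add: algebra_simps)
    also have "\<dots> = A x * (1 + (a y - a x) * (d / A x))" using pos by (simp add: field_simps)
    also have "\<dots> \<le> A x * (1 + (a y - a x) * (d / A t))"
    proof -
      have "A t \<le> A x"
      proof -
        have "0 \<le> a x * d" using d0 pos by simp
        then show ?thesis using AtAy Ax by simp
      qed
      then have "d / A x \<le> d / A t" using pos d0 by (intro divide_left_mono) auto
      then show ?thesis using pos by (intro mult_left_mono add_left_mono) auto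
    qed
    also have "\<dots> \<le> A x * exp ((a y - a x) * (d / A t))"
      using pos by (intro mult_left_mono exp_ge_add_one_self) auto
    finally have "r y * (A y + a y * d) \<le> r y * (A x * exp ((a y - a x) * (d / A t)))"
      using ry by (rule mult_left_mono)
    with Bx have "B x \<le> r y * (A x * exp ((a y - a x) * (d / A t)))" by simp
    then show ?thesis using pos by (simp add: r_def[of x] d_def field_simps)
  qed
  have r0: "0 \<le> r t" "0 < A t" using A0 B0 assms(1) by (auto simp: r_def intro!: divide_nonneg_pos)
  have part: "r s \<le> r t * exp ((a t - a s) * (((t - s) / real (Suc N)) / A t))" for N
  proof -
    define d where "d = (t - s) / real (Suc N)"
    have d0: "0 \<le> d" and Nd: "real (Suc N) * d = t - s" using assms(1) by (auto simp: d_def)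
    have "k \<le> Suc N \<Longrightarrow> r s \<le> r (s + real k * d) * exp ((a (s + real k * d) - a s) * (d / A t))" for k
    proof (induction k)
      case (Suc k)
      let ?x = "s + real k * d" and ?y = "s + real (Suc k) * d"
      have "real (Suc k) * d \<le> real (Suc N) * d" using Suc.prems d0 by (intro mult_right_mono) auto
      then have "?y \<le> t" using Nd by simp
      have "?x \<le> ?y" using d0 by (simp add: algebra_simps)
      have "r s \<le> r ?x * exp ((a ?x - a s) * (d / A t))" using Suc by simp
      also have "\<dots> \<le> (r ?y * exp ((a ?y - a ?x) * (d / A t))) * exp ((a ?x - a s) * (d / A t))"
        using step[of ?x ?y] \<open>?x \<le> ?y\<close> \<open>?y \<le> t\<close> d0 by (intro mult_right_mono) (auto simp: algebra_simps)
      also have "\<dots> = r ?y * exp ((a ?y - a s) * (d / A t))"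
        by (simp only: mult.assoc exp_add[symmetric]) (simp only: distrib_right[symmetric], simp)
      finally show ?case .
    qed simp
    from this[of "Suc N"] show ?thesis by (simp only: Nd order_refl simp_thms d_def[symmetric]) simp
  qed
  have "(\<lambda>N. r t * exp ((a t - a s) * (((t - s) / real (Suc N)) / A t)))
      \<longlonglongrightarrow> r t * exp ((a t - a s) * (0 / A t))"
    using r0 by (intro tendsto_intros filterlim_compose[OF _ filterlim_Suc, of "\<lambda>N. (t - s) / real N"] lim_const_over_n) auto
  then have "r s \<le> r t" using part by (intro LIMSEQ_le_const) auto
  then show ?thesis using r0 A0[of s] assms(1) by (simp add: r_def field_simps)
qed

text \<open>Formally the derivatives of \<open>A\<close> and \<open>B\<close> are \<open>-a\<close>
  and \<open>-b\<close>, and \<open>bA\<close> says \<open>b / B \<le> a / A\<close>. Monotone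
  integrands yield the difference bounds \<open>lower\<close> and \<open>upper\<close> that replace
  these derivatives at jumps.\<close>

lemma tail_integral_ratio_mono:
  fixes a b :: "real \<Rightarrow> real"
  defines "A \<equiv> \<lambda>s. \<integral>\<^sup>+x. ennreal (a x) * indicator {s<..<1} x \<partial>lborel"
    and "B \<equiv> \<lambda>s. \<integral>\<^sup>+x. ennreal (b x) * indicator {s<..<1} x \<partial>lborel"
  assumes [measurable]: "a \<in> borel_measurable borel" "b \<in> borel_measurable borel"
    and a_mono: "\<And>x y. 0 < x \<Longrightarrow> x \<le> y \<Longrightarrow> y < 1 \<Longrightarrow> a x \<le> a y"
    and b_mono: "\<And>x y. 0 < x \<Longrightarrow> x \<le> y \<Longrightarrow> y < 1 \<Longrightarrow> b x \<le> b y"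
    and a_pos: "\<And>x. 0 < x \<Longrightarrow> x < 1 \<Longrightarrow> 0 < a x"
    and b_pos: "\<And>x. 0 < x \<Longrightarrow> x < 1 \<Longrightarrow> 0 < b x"
    and A_fin: "A 0 < \<top>" and B_fin: "B 0 < \<top>"
    and bA: "\<And>s. 0 < s \<Longrightarrow> s < 1 \<Longrightarrow> ennreal (b s) * A s \<le> ennreal (a s) * B s"
    and st: "0 < s" "s \<le> t" "t < 1"
  shows "B s * A t \<le> B t * A s"
proof -
  have lower: "ennreal (f x * (y - x)) + (\<integral>\<^sup>+u. ennreal (f u) * indicator {y<..<1} u \<partial>lborel)
      \<le> (\<integral>\<^sup>+u. ennreal (f u) * indicator {x<..<1} u \<partial>lborel)"
    if [measurable]: "f \<in> borel_measurable borel" and pos: "0 \<le> f x"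
      and f: "\<And>x y. 0 < x \<Longrightarrow> x \<le> y \<Longrightarrow> y < 1 \<Longrightarrow> f x \<le> f y"
      and xy: "0 < x" "x \<le> y" "y \<le> 1" for f :: "real \<Rightarrow> real" and x y
  proof -
    have "ennreal (f x * (y - x)) = (\<integral>\<^sup>+u. ennreal (f x) * indicator {x<..<y} u \<partial>lborel)"
      using pos xy by (simp add: nn_integral_cmult ennreal_mult)
    then have "ennreal (f x * (y - x)) + (\<integral>\<^sup>+u. ennreal (f u) * indicator {y<..<1} u \<partial>lborel)
      = (\<integral>\<^sup>+u. ennreal (f x) * indicator {x<..<y} u + ennreal (f u) * indicator {y<..<1} u \<partial>lborel)"
      by (simp add: nn_integral_add)
    also have "\<dots> \<le> (\<integral>\<^sup>+u. ennreal (f u) * indicator {x<..<1} u \<partial>lborel)"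
      using xy by (intro nn_integral_mono) (auto split: split_indicator intro!: ennreal_leI f)
    finally show ?thesis .
  qed
  have upper: "(\<integral>\<^sup>+u. ennreal (f u) * indicator {x<..<1} u \<partial>lborel)
      \<le> ennreal (f y * (y - x)) + (\<integral>\<^sup>+u. ennreal (f u) * indicator {y<..<1} u \<partial>lborel)"
    if [measurable]: "f \<in> borel_measurable borel" and pos: "0 \<le> f y"
      and f: "\<And>x y. 0 < x \<Longrightarrow> x \<le> y \<Longrightarrow> y < 1 \<Longrightarrow> f x \<le> f y"
      and xy: "0 < x" "x \<le> y" "y < 1" for f :: "real \<Rightarrow> real" and x y
  proof -
    have "ennreal (f y * (y - x)) = (\<integral>\<^sup>+u. ennreal (f y) * indicator {x<..y} u \<partial>lborel)"
      using pos xy by (simp add: nn_integral_cmult ennreal_mult)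
    then have "ennreal (f y * (y - x)) + (\<integral>\<^sup>+u. ennreal (f u) * indicator {y<..<1} u \<partial>lborel)
      = (\<integral>\<^sup>+u. ennreal (f y) * indicator {x<..y} u + ennreal (f u) * indicator {y<..<1} u \<partial>lborel)"
      by (simp add: nn_integral_add)
    moreover have "(\<integral>\<^sup>+u. ennreal (f u) * indicator {x<..<1} u \<partial>lborel)
      \<le> (\<integral>\<^sup>+u. ennreal (f y) * indicator {x<..y} u + ennreal (f u) * indicator {y<..<1} u \<partial>lborel)"
      using xy by (intro nn_integral_mono) (auto split: split_indicator intro!: ennreal_leI f)
    ultimately show ?thesis by simp
  qed
  have A_le: "A x \<le> A 0" and B_le: "B x \<le> B 0" if "0 < x" for x
    unfolding A_def B_def using that
    by (auto intro!: nn_integral_mono split: split_indicator)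
  define A' B' where "A' x = enn2real (A x)" and "B' x = enn2real (B x)" for x
  have A': "A x = ennreal (A' x)" and B': "B x = ennreal (B' x)" if "0 < x" for x
    using A_le[OF that] B_le[OF that] A_fin B_fin by (auto simp: A'_def B'_def)
  have nn: "0 \<le> A' x" "0 \<le> B' x" for x by (auto simp: A'_def B'_def)
  have "B' s * A' t \<le> B' t * A' s"
  proof (rule ratio_mono_of_logderiv_le[where a = a and b = b])
    fix x assume x: "s \<le> x" "x \<le> t"
    \<comment> \<open>With right end 1 the lower bound becomes positivity of the tail integral,
      which is why \<open>lower\<close> admits \<open>y = 1\<close>.\<close>
    have "ennreal (a x * (1 - x)) \<le> A x"
      unfolding A_def using lower[of a x 1] a_mono a_pos[of x] x st by simp
    moreover have "0 < a x * (1 - x)" using a_pos[of x] x st by simp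
    ultimately show "0 < A' x" using A'[of x] nn[of x] x st by (auto simp: ennreal_le_iff)
    show "b x * A' x \<le> a x * B' x"
      using bA[of x] x st A'[of x] B'[of x] nn[of x] a_pos[of x] b_pos[of x]
      by (auto simp: ennreal_mult[symmetric])
  next
    fix x y assume xy: "s \<le> x" "x \<le> y" "y \<le> t"
    have "ennreal (a x * (y - x)) + A y \<le> A x"
      unfolding A_def using a_pos[of x] xy st by (intro lower) (auto intro: a_mono)
    then have "a x * (y - x) + A' y \<le> A' x"
      using A'[of x] A'[of y] nn a_pos[of x] xy st by (simp flip: ennreal_plus)
    then show "a x * (y - x) \<le> A' x - A' y" by simp
    have "B x \<le> ennreal (b y * (y - x)) + B y"
      unfolding B_def using b_pos[of y] xy st by (intro upper) (auto intro: b_mono)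
    then have "B' x \<le> b y * (y - x) + B' y"
      using B'[of x] B'[of y] nn b_pos[of y] xy st by (simp flip: ennreal_plus)
    then show "B' x - B' y \<le> b y * (y - x)" by simp
  qed (use st nn a_mono a_pos in \<open>auto intro: less_imp_le\<close>)
  then show ?thesis
    using A'[of s] A'[of t] B'[of s] B'[of t] nn st by (simp add: ennreal_mult[symmetric])
qed

lemma ennreal_add_le_cancel_left:
  fixes q x y :: ennreal
  shows "q + x \<le> q + y \<Longrightarrow> q < \<top> \<Longrightarrow> x \<le> y"
  by auto

text \<open>
  Put \<open>\<lambda> = \<integral> b w2 / \<integral> a w2\<close>. By monotonicity of \<open>B / A\<close> the tails of \<open>b - \<lambda> a\<close> change sign at most
  once, from negative to nonnegative, and where they are negative so is \<open>b - \<lambda> a\<close> itself. Hence all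
  tails of \<open>(b - \<lambda> a) w2\<close> are nonnegative, first on the right of the sign change by layers of \<open>w2\<close>,
  then on the left because the total integral vanishes. Layers of the increasing function
  \<open>w1 / w2\<close> conclude.
\<close>

lemma weighted_integral_ratio_le:
  fixes a b :: "real \<Rightarrow> real" and w1 w2 :: "real \<Rightarrow> ennreal" and E :: "real set"
  defines "A \<equiv> \<lambda>s. \<integral>\<^sup>+x. ennreal (a x) * indicator {s<..<1} x \<partial>lborel"
    and "B \<equiv> \<lambda>s. \<integral>\<^sup>+x. ennreal (b x) * indicator {s<..<1} x \<partial>lborel"
    and "I \<equiv> \<lambda>f w. \<integral>\<^sup>+x. ennreal (f x) * w x * indicator E x \<partial>lborel"
  assumes [measurable]: "a \<in> borel_measurable borel" "b \<in> borel_measurable borel"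
    "w1 \<in> borel_measurable borel" "w2 \<in> borel_measurable borel" "E \<in> sets borel"
    and E: "E \<subseteq> {0<..<1}" "AE x in lborel. x \<in> {0<..<1} \<longrightarrow> x \<in> E"
    and a_mono: "\<And>x y. 0 < x \<Longrightarrow> x \<le> y \<Longrightarrow> y < 1 \<Longrightarrow> a x \<le> a y"
    and b_mono: "\<And>x y. 0 < x \<Longrightarrow> x \<le> y \<Longrightarrow> y < 1 \<Longrightarrow> b x \<le> b y"
    and a_pos: "\<And>x. 0 < x \<Longrightarrow> x < 1 \<Longrightarrow> 0 < a x"
    and b_pos: "\<And>x. 0 < x \<Longrightarrow> x < 1 \<Longrightarrow> 0 < b x"
    and A_fin: "A 0 < \<top>" and B_fin: "B 0 < \<top>"
    and bA: "\<And>s. 0 < s \<Longrightarrow> s < 1 \<Longrightarrow> ennreal (b s) * A s \<le> ennreal (a s) * B s"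
    and w2_le1: "\<And>x. x \<in> E \<Longrightarrow> w2 x \<le> 1"
    and w2_mono: "\<And>x y. x \<in> E \<Longrightarrow> y \<in> E \<Longrightarrow> x \<le> y \<Longrightarrow> w2 x \<le> w2 y"
    and tp: "\<And>x y. x \<in> E \<Longrightarrow> y \<in> E \<Longrightarrow> x \<le> y \<Longrightarrow> w1 x * w2 y \<le> w1 y * w2 x"
    and nz: "I a w2 \<noteq> 0"
  shows "I a w1 * I b w2 \<le> I b w1 * I a w2"
proof -
  have ratio: "B s * A t \<le> B t * A s" if "0 < s" "s \<le> t" "t < 1" for s t
    unfolding A_def B_def
    using that bA A_fin B_fin a_mono b_mono a_pos b_pos unfolding A_def B_def
    by (intro tail_integral_ratio_mono) auto
  have I_le: "I f w2 \<le> (\<integral>\<^sup>+x. ennreal (f x) * indicator {0<..<1} x \<partial>lborel)" for f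
  proof -
    have "ennreal (f x) * w2 x \<le> ennreal (f x)" if "x \<in> E" for x
      using mult_left_mono[OF w2_le1[OF that], of "ennreal (f x)"] by simp
    then show ?thesis
      unfolding I_def using E by (intro nn_integral_mono) (auto split: split_indicator)
  qed
  have Ia_fin: "I a w2 < \<top>" and Ib_fin: "I b w2 < \<top>"
    using I_le[of a] I_le[of b] A_fin B_fin by (auto simp: A_def B_def)
  define l where "l = I b w2 / I a w2"
  have l_fin: "l < \<top>" using Ib_fin nz by (auto simp: l_def ennreal_divide_eq_top_iff less_top[symmetric] top_unique)
  have l_eq: "l * I a w2 = I b w2"
    using nz Ia_fin by (simp add: l_def ennreal_divide_times ennreal_divide_self)
  have A_pos: "0 < A s" if "0 < s" "s < 1" for s
  proof (rule ccontr)
    assume "\<not> 0 < A s"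
    then have "AE x in lborel. ennreal (a x) * indicator {s<..<1} x = 0"
      unfolding A_def by (subst (asm) not_gr_zero, subst (asm) nn_integral_0_iff_AE) auto
    moreover have "ennreal (a x) * indicator {s<..<1} x = 0 \<longleftrightarrow> x \<notin> {s<..<1}" for x
      using a_pos[of x] that by (auto split: split_indicator simp: ennreal_eq_0_iff not_le)
    ultimately have "AE x in lborel. x \<notin> {s<..<1}" by simp
    then have "{s<..<1} \<in> null_sets lborel" by (subst AE_iff_null_sets) auto
    then have "emeasure lborel {s<..<1} = 0" by (rule null_setsD1)
    then show False using that by simp
  qed
  have A_fin': "A s < \<top>" if "0 \<le> s" for s
  proof -
    have "A s \<le> A 0" unfolding A_def using that by (auto intro!: nn_integral_mono split: split_indicator)
    then show ?thesis using A_fin by simp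
  qed
  define T where "T = {s \<in> {0<..<1}. B s < l * A s}"
  \<comment> \<open>\<open>B / A\<close> is nondecreasing, so once below \<open>l\<close> it is
    below \<open>l\<close> everywhere to the left.\<close>
  have T_down: "s \<in> T" if "t \<in> T" "0 < s" "s \<le> t" for s t
  proof (rule ccontr)
    assume "s \<notin> T"
    then have "l * A s \<le> B s" using that by (auto simp: T_def)
    have "A s * (l * A t) \<le> B s * A t"
      using mult_right_mono[OF \<open>l * A s \<le> B s\<close>, of "A t"] by (simp add: mult_ac)
    also have "\<dots> \<le> A s * B t" using ratio[of s t] that by (simp add: T_def mult_ac)
    finally have "l * A t \<le> B t"
      using A_pos[of s] A_fin'[of s] that by (subst (asm) ennreal_mult_le_mult_iff) (auto simp: T_def)
    then show False using that by (auto simp: T_def)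
  qed
  \<comment> \<open>The pointwise sign comes from \<open>bA\<close>: on \<open>T\<close>,
    \<open>b * A \<le> a * B \<le> l * a * A\<close>, and \<open>A\<close> is positive and
    finite.\<close>
  have T_le: "ennreal (b s) \<le> l * ennreal (a s)" if "s \<in> T" for s
  proof -
    have s: "0 < s" "s < 1" using that by (auto simp: T_def)
    have "A s * ennreal (b s) \<le> ennreal (a s) * B s" using bA[OF s] by (simp add: mult.commute)
    also have "\<dots> \<le> ennreal (a s) * (l * A s)" using that by (intro mult_left_mono) (auto simp: T_def)
    finally have "A s * ennreal (b s) \<le> A s * (l * ennreal (a s))" by (simp add: mult_ac)
    then show ?thesis
      using A_pos[OF s] A_fin'[of s] s by (subst (asm) ennreal_mult_le_mult_iff) auto
  qed
  have tail: "l * (\<integral>\<^sup>+x. ennreal (a x) * indicator S x \<partial>lborel)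
      \<le> (\<integral>\<^sup>+x. ennreal (b x) * indicator S x \<partial>lborel)"
    if S: "S \<subseteq> E" "S \<inter> T = {}" and up: "\<And>x y. x \<in> S \<Longrightarrow> y \<in> E \<Longrightarrow> x \<le> y \<Longrightarrow> y \<in> S" for S
  proof (cases "S = {}")
    case False
    define s where "s = Inf S"
    have bdd: "bdd_below S" using S E by (auto intro!: bdd_belowI[of _ 0])
    have s0: "0 \<le> s" unfolding s_def using False S E by (intro cInf_greatest) auto
    have s_lower: "s \<le> x" if "x \<in> S" for x unfolding s_def using bdd that by (rule cInf_lower[rotated])
    have near: "\<exists>y\<in>S. y < x" if "s < x" for x
      using that False bdd by (simp add: s_def cInf_less_iff)
    \<comment> \<open>An upper subset of \<open>E\<close> differs from the interval above its
      infimum only by a null set, so its integral is a tail integral.\<close>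
    have eq: "(\<integral>\<^sup>+x. ennreal (f x) * indicator S x \<partial>lborel)
        = (\<integral>\<^sup>+x. ennreal (f x) * indicator {s<..<1} x \<partial>lborel)" for f
    proof (rule nn_integral_cong_AE)
      show "AE x in lborel. ennreal (f x) * indicator S x = ennreal (f x) * indicator {s<..<1} x"
        using E(2) AE_lborel_singleton[of s]
      proof eventually_elim
        case (elim x)
        have "x \<in> S \<longleftrightarrow> x \<in> {s<..<1}"
        proof
          assume "x \<in> S"
          then show "x \<in> {s<..<1}" using s_lower[of x] S E elim by (auto simp: order.order_iff_strict)
        next
          assume x: "x \<in> {s<..<1}"
          then obtain y where "y \<in> S" "y < x" using near by auto
          then show "x \<in> S" using up[of y x] elim x s0 by auto
        qed
        then show ?case by (auto split: split_indicator)
      qed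
    qed
    \<comment> \<open>The infimum \<open>s\<close> need not belong to \<open>S\<close> and may be 0.
      The tail inequality is therefore taken at \<open>s + 1 / (k + 1)\<close>, which lies above a
      point of \<open>S\<close> and hence outside \<open>T\<close>, and passed to the limit by
      monotone convergence.\<close>
    have SUP_eq: "(SUP k. \<integral>\<^sup>+x. ennreal (f x) * indicator {s + 1 / real (Suc k)<..<1} x \<partial>lborel)
      = (\<integral>\<^sup>+x. ennreal (f x) * indicator {s<..<1} x \<partial>lborel)"
      if [measurable]: "f \<in> borel_measurable borel" for f :: "real \<Rightarrow> real"
    proof -
      have *: "(\<integral>\<^sup>+x. ennreal (f x) * indicator {u<..<1} x \<partial>lborel)
          = emeasure (density lborel (\<lambda>x. ennreal (f x))) {u<..<1}" for u
        by (subst emeasure_density) auto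
      have "(\<Union>k. {s + 1 / real (Suc k)<..<1}) = {s<..<1}"
      proof safe
        fix x k assume "x \<in> {s + 1 / real (Suc k)<..<1}"
        moreover have "0 < 1 / real (Suc k)" by simp
        ultimately show "x \<in> {s<..<1}" unfolding greaterThanLessThan_iff by linarith
      next
        fix x assume x: "x \<in> {s<..<1}"
        then obtain k where "inverse (real (Suc k)) < x - s"
          using reals_Archimedean[of "x - s"] by auto
        then show "x \<in> (\<Union>k. {s + 1 / real (Suc k)<..<1})"
          using x by (auto intro!: exI[of _ k] simp: inverse_eq_divide)
      qed
      moreover have "incseq (\<lambda>k. {s + 1 / real (Suc k)<..<1})"
      proof (rule incseq_SucI)
        fix k
        have "1 / real (Suc (Suc k)) \<le> 1 / real (Suc k)" by (intro frac_le) auto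
        then show "{s + 1 / real (Suc k)<..<1} \<subseteq> {s + 1 / real (Suc (Suc k))<..<1}"
          by (intro subsetI) (unfold greaterThanLessThan_iff, linarith)
      qed
      ultimately show ?thesis
        unfolding * by (subst SUP_emeasure_incseq) auto
    qed
    have "l * A (s + 1 / real (Suc k)) \<le> B (s + 1 / real (Suc k))" for k
    proof (cases "s + 1 / real (Suc k) < 1")
      case True
      have "s < s + 1 / real (Suc k)" by simp
      then obtain y where y: "y \<in> S" "y < s + 1 / real (Suc k)" using near by blast
      then have "y \<notin> T" "0 < y" using S E by auto
      then have "s + 1 / real (Suc k) \<notin> T" using T_down[of "s + 1 / real (Suc k)" y] y by auto
      then show ?thesis using True y \<open>0 < y\<close> by (auto simp: T_def)
    qed (simp add: A_def)
    then have "(SUP k. l * A (s + 1 / real (Suc k))) \<le> (SUP k. B (s + 1 / real (Suc k)))"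
      by (intro SUP_mono) auto
    then show ?thesis
      unfolding eq A_def B_def SUP_mult_left_ennreal[symmetric] by (subst (asm) (1 2) SUP_eq) auto
  qed simp
  have wtail: "(\<integral>\<^sup>+x. l * ennreal (a x) * w2 x * indicator S x \<partial>lborel)
      \<le> (\<integral>\<^sup>+x. ennreal (b x) * w2 x * indicator S x \<partial>lborel)"
    if [measurable]: "S \<in> sets borel" and S: "S \<subseteq> E"
      and up: "\<And>x y. x \<in> S \<Longrightarrow> y \<in> E \<Longrightarrow> x \<le> y \<Longrightarrow> y \<in> S" for S
  proof (cases "S \<inter> T = {}")
    case True
    have "(\<integral>\<^sup>+x. (l * ennreal (a x) * indicator S x) * w2 x \<partial>lborel)
      \<le> (\<integral>\<^sup>+x. (ennreal (b x) * indicator S x) * w2 x \<partial>lborel)"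
    proof (rule nn_integral_mult_mono_layers)
      fix z :: real
      let ?S = "{u \<in> S. ennreal z < w2 u}"
      have "l * (\<integral>\<^sup>+x. ennreal (a x) * indicator ?S x \<partial>lborel)
          \<le> (\<integral>\<^sup>+x. ennreal (b x) * indicator ?S x \<partial>lborel)"
      proof (rule tail)
        show "?S \<subseteq> E" "?S \<inter> T = {}" using S True by auto
        show "y \<in> ?S" if "x \<in> ?S" "y \<in> E" "x \<le> y" for x y
          using that up[of x y] w2_mono[of x y] S by (auto dest: less_le_trans)
      qed
      then have "(\<integral>\<^sup>+x. l * (ennreal (a x) * indicator ?S x) \<partial>lborel)
          \<le> (\<integral>\<^sup>+x. ennreal (b x) * indicator ?S x \<partial>lborel)"
        by (subst nn_integral_cmult) auto
      moreover have "(\<integral>\<^sup>+x. l * (ennreal (a x) * indicator ?S x) \<partial>lborel)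
        = (\<integral>\<^sup>+u. l * ennreal (a u) * indicator S u * indicator {u. ennreal z < w2 u} u \<partial>lborel)"
        by (intro nn_integral_cong) (auto split: split_indicator)
      moreover have "(\<integral>\<^sup>+x. ennreal (b x) * indicator ?S x \<partial>lborel)
        = (\<integral>\<^sup>+u. ennreal (b u) * indicator S u * indicator {u. ennreal z < w2 u} u \<partial>lborel)"
        by (intro nn_integral_cong) (auto split: split_indicator)
      ultimately show "(\<integral>\<^sup>+u. l * ennreal (a u) * indicator S u * indicator {u. ennreal z < w2 u} u \<partial>lborel)
        \<le> (\<integral>\<^sup>+u. ennreal (b u) * indicator S u * indicator {u. ennreal z < w2 u} u \<partial>lborel)"
        by simp
    qed (auto intro: lborel.sigma_finite_measure_axioms)
    then show ?thesis by (simp add: mult_ac)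
  next
    case False
    then obtain x where x: "x \<in> S" "x \<in> T" by auto
    have sub: "E - S \<subseteq> T"
    proof
      fix y assume y: "y \<in> E - S"
      then have "y \<le> x" using up[OF x(1), of y] by (cases "x \<le> y") auto
      then show "y \<in> T" using T_down[OF x(2), of y] y E by auto
    qed
    have split: "(\<integral>\<^sup>+x. f x * w2 x * indicator E x \<partial>lborel)
        = (\<integral>\<^sup>+x. f x * w2 x * indicator (E - S) x \<partial>lborel) + (\<integral>\<^sup>+x. f x * w2 x * indicator S x \<partial>lborel)"
      if [measurable]: "f \<in> borel_measurable borel" for f
      using S by (subst nn_integral_add[symmetric])
        (auto intro!: nn_integral_cong split: split_indicator)
    define q where "q = (\<integral>\<^sup>+x. l * ennreal (a x) * w2 x * indicator (E - S) x \<partial>lborel)"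
    have lIa: "(\<integral>\<^sup>+x. l * ennreal (a x) * w2 x * indicator E x \<partial>lborel) = l * I a w2"
      unfolding I_def by (subst nn_integral_cmult[symmetric]) (auto simp: mult.assoc)
    have "q \<le> l * I a w2" unfolding lIa[symmetric] q_def
      by (intro nn_integral_mono) (auto split: split_indicator)
    then have q_fin: "q < \<top>" using Ib_fin by (simp add: l_eq)
    have "(\<integral>\<^sup>+x. ennreal (b x) * w2 x * indicator (E - S) x \<partial>lborel) \<le> q"
      unfolding q_def using sub T_le
      by (intro nn_integral_mono) (auto split: split_indicator intro!: mult_right_mono)
    then have "I b w2 \<le> q + (\<integral>\<^sup>+x. ennreal (b x) * w2 x * indicator S x \<partial>lborel)"
      unfolding I_def by (subst split) (auto intro: add_right_mono)
    moreover have "I b w2 = q + (\<integral>\<^sup>+x. l * ennreal (a x) * w2 x * indicator S x \<partial>lborel)"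
      unfolding l_eq[symmetric] lIa[symmetric] q_def by (subst split) auto
    ultimately show ?thesis using q_fin by (auto intro: ennreal_add_le_cancel_left[of q])
  qed
  define r where "r x = w1 x / w2 x" for x
  have [measurable]: "r \<in> borel_measurable borel" unfolding r_def by measurable
  \<comment> \<open>The quotient \<open>r\<close> recovers \<open>w1\<close> only if
    \<open>w1\<close> vanishes wherever \<open>w2\<close> does, since \<open>0 / 0 = 0\<close> in
    \<open>ennreal\<close>. By \<open>nz\<close> some y has \<open>w2 y \<noteq> 0\<close>; it lies
    to the right of x, and \<open>tp\<close> then forces \<open>w1 x * w2 y \<le> 0\<close>.\<close>
  have w1_0: "w1 x = 0" if "x \<in> E" "w2 x = 0" for x
  proof -
    have "\<exists>y\<in>E. w2 y \<noteq> 0"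
    proof (rule ccontr)
      assume "\<not> ?thesis"
      then have "ennreal (a x) * w2 x * indicator E x = 0" for x
        by (auto split: split_indicator)
      then have "(\<lambda>x. ennreal (a x) * w2 x * indicator E x) = (\<lambda>x. 0)" by (rule ext)
      then have "I a w2 = 0" unfolding I_def by (simp only: nn_integral_0_iff_AE nn_integral_const mult_zero_left)
      then show False using nz by simp
    qed
    then obtain y where y: "y \<in> E" "w2 y \<noteq> 0" by auto
    have "x \<le> y" using w2_mono[of y x] that y by (cases "x \<le> y") auto
    then show ?thesis using tp[of x y] that y by auto
  qed
  have w2_top: "w2 x \<noteq> \<top>" if "x \<in> E" for x using w2_le1[OF that] by (auto simp: top_unique)
  have w1_eq: "w2 x * r x = w1 x" if "x \<in> E" for x
    using w1_0[OF that] w2_top[OF that]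
    by (cases "w2 x = 0") (auto simp: r_def ennreal_times_divide ennreal_mult_divide_eq mult.commute)
  have r_mono: "r x \<le> r y" if "x \<in> E" "y \<in> E" "x \<le> y" for x y
  proof (cases "w2 x = 0")
    case True
    then show ?thesis using w1_0[of x] that by (simp add: r_def)
  next
    case False
    have y: "w2 y \<noteq> 0" using False w2_mono[OF that] by auto
    have "w2 x * w2 y * r x \<le> w2 x * w2 y * r y"
      using tp[OF that] w1_eq[OF that(1)] w1_eq[OF that(2)] by (metis mult.assoc mult.commute)
    moreover have "w2 x * w2 y \<noteq> 0" "w2 x * w2 y \<noteq> \<top>"
      using False y w2_top that by (auto simp: ennreal_mult_eq_top_iff)
    ultimately show ?thesis
      by (subst (asm) ennreal_mult_le_mult_iff) auto
  qed
  have "(\<integral>\<^sup>+x. (l * ennreal (a x) * w2 x * indicator E x) * r x \<partial>lborel)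
    \<le> (\<integral>\<^sup>+x. (ennreal (b x) * w2 x * indicator E x) * r x \<partial>lborel)"
  proof (rule nn_integral_mult_mono_layers)
    fix z :: real
    let ?S = "{u \<in> E. ennreal z < r u}"
    have "(\<integral>\<^sup>+x. l * ennreal (a x) * w2 x * indicator ?S x \<partial>lborel)
        \<le> (\<integral>\<^sup>+x. ennreal (b x) * w2 x * indicator ?S x \<partial>lborel)"
      using r_mono by (intro wtail) (auto dest: less_le_trans)
    moreover have "indicator ?S u = indicator E u * (indicator {u. ennreal z < r u} u :: ennreal)" for u
      by (auto split: split_indicator)
    ultimately show "(\<integral>\<^sup>+u. l * ennreal (a u) * w2 u * indicator E u * indicator {u. ennreal z < r u} u \<partial>lborel)
      \<le> (\<integral>\<^sup>+u. ennreal (b u) * w2 u * indicator E u * indicator {u. ennreal z < r u} u \<partial>lborel)"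
      by (simp only: mult.assoc)
  qed (auto intro: lborel.sigma_finite_measure_axioms)
  moreover have "(\<integral>\<^sup>+x. (l * ennreal (a x) * w2 x * indicator E x) * r x \<partial>lborel) = l * I a w1"
    unfolding I_def by (subst nn_integral_cmult[symmetric])
      (auto intro!: nn_integral_cong split: split_indicator simp: w1_eq[symmetric] mult_ac)
  moreover have "(\<integral>\<^sup>+x. (ennreal (b x) * w2 x * indicator E x) * r x \<partial>lborel) = I b w1"
    unfolding I_def
    by (auto intro!: nn_integral_cong split: split_indicator simp: w1_eq[symmetric] mult_ac)
  ultimately have "l * I a w1 \<le> I b w1" by simp
  then have "(l * I a w1) * I a w2 \<le> I b w1 * I a w2" by (rule mult_right_mono) simp
  then show ?thesis by (simp add: l_eq[symmetric] mult_ac)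
qed

section \<open>Quantiles\<close>

lemma dist_fun_eq:
  assumes "Z \<in> borel_measurable P"
  shows "dist_fun P Z x = measure P {\<omega> \<in> space P. Z \<omega> \<le> x}"
  using assms by (auto simp: dist_fun_def cdf_def measure_distr intro!: arg_cong[where f = "measure P"])

lemma cdf_distribution_distr:
  assumes "prob_space P" and "Z \<in> borel_measurable P"
  shows "cdf_distribution (distr P borel Z)"
  unfolding cdf_distribution_def
  using assms by (auto intro: prob_space.real_distribution_distr)

lemma mono_dist_fun:
  assumes "prob_space P" and "Z \<in> borel_measurable P"
  shows "mono (dist_fun P Z)"
proof -
  interpret cdf_distribution "distr P borel Z" by (rule cdf_distribution_distr[OF assms])
  show ?thesis unfolding dist_fun_def by (rule mono)
qed

lemma borel_measurable_dist_fun: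
  assumes "prob_space P" and "Z \<in> borel_measurable P"
  shows "dist_fun P Z \<in> borel_measurable borel"
  by (intro borel_measurable_mono mono_dist_fun assms)

text \<open>The Galois connection between quantile and distribution function: for a level inside
  (0,1) the set in the infimum is nonempty, bounded below and, by right continuity, closed. Most
  later facts on quantiles come from it.\<close>

lemma VaR_le_iff:
  assumes "prob_space P" and "Z \<in> borel_measurable P" and "0 < t" "t < 1"
  shows "VaR P Z t \<le> x \<longleftrightarrow> t \<le> dist_fun P Z x"
proof -
  interpret cdf_distribution "distr P borel Z" by (rule cdf_distribution_distr[OF assms(1,2)])
  show ?thesis unfolding VaR_def dist_fun_def using pseudoinverse[OF assms(3,4), of x] by simp
qed

lemma mono_VaR:
  assumes "prob_space P" and "Z \<in> borel_measurable P" and "0 < s" "s \<le> t" "t < 1"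
  shows "VaR P Z s \<le> VaR P Z t"
  using VaR_le_iff[OF assms(1,2), of s "VaR P Z t"] VaR_le_iff[OF assms(1,2), of t "VaR P Z t"] assms
  by auto

text \<open>Outside (0,1) the infimum may be over an empty or unbounded set and then carries no
  meaning. The value 0 there gives a Borel function on the whole line, monotone on the part that
  matters.\<close>

lemma borel_measurable_VaR:
  assumes "prob_space P" and "Z \<in> borel_measurable P"
  shows "(\<lambda>t. if t \<in> {0<..<1} then VaR P Z t else 0) \<in> borel_measurable borel"
proof -
  have "VaR P Z \<in> borel_measurable (restrict_space borel {0<..<1})"
    using mono_VaR[OF assms] by (intro borel_measurable_mono_on_fnc) (auto simp: mono_on_def)
  then show ?thesis by (subst measurable_If_restrict_space_iff) (simp_all del: greaterThanLessThan_iff)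
qed

text \<open>Inverse transform: the quantile at a uniform level has the law of
  \<open>Z\<close>.\<close>

lemma nn_integral_VaR:
  fixes h :: "real \<Rightarrow> ennreal"
  assumes "prob_space P" and [measurable]: "Z \<in> borel_measurable P" "h \<in> borel_measurable borel"
  shows "(\<integral>\<^sup>+t. h (VaR P Z t) * indicator {0<..<1} t \<partial>lborel) = (\<integral>\<^sup>+\<omega>. h (Z \<omega>) \<partial>P)"
proof -
  interpret cdf_distribution "distr P borel Z" by (rule cdf_distribution_distr[OF assms(1,2)])
  have VaR_eq: "VaR P Z = (\<lambda>t. Inf {x. t \<le> cdf (distr P borel Z) x})"
    by (simp add: VaR_def dist_fun_def fun_eq_iff)
  have [measurable]: "VaR P Z \<in> borel_measurable (restrict_space lborel {0<..<1})"
    unfolding VaR_eq using measurable_CI by (simp cong: measurable_cong_sets sets_restrict_space_cong)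
  have "(\<integral>\<^sup>+\<omega>. h (Z \<omega>) \<partial>P) = (\<integral>\<^sup>+z. h z \<partial>distr P borel Z)"
    by (subst nn_integral_distr) auto
  also have "distr P borel Z = distr (restrict_space lborel {0<..<1}) borel (VaR P Z)"
    unfolding VaR_eq by (rule distr_I_eq_M[symmetric])
  also have "(\<integral>\<^sup>+z. h z \<partial>\<dots>) = (\<integral>\<^sup>+t. h (VaR P Z t) \<partial>restrict_space lborel {0<..<1})"
    by (subst nn_integral_distr) auto
  also have "\<dots> = (\<integral>\<^sup>+t. h (VaR P Z t) * indicator {0<..<1} t \<partial>lborel)"
    by (subst nn_integral_restrict_space) auto
  finally show ?thesis by simp
qed

lemma continuous_on_less_left:
  fixes F :: "real \<Rightarrow> real"
  assumes "continuous_on UNIV F" and "c < F y"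
  shows "\<exists>x<y. c < F x"
proof -
  have "(F \<longlongrightarrow> F y) (at_left y)"
    using assms(1) by (auto simp: continuous_on_def intro: tendsto_within_subset)
  then have "eventually (\<lambda>x. c < F x) (at_left y)" using assms(2) by (rule order_tendstoD)
  moreover have "eventually (\<lambda>x. x < y) (at_left y)" by (auto simp: eventually_at_filter)
  ultimately have "eventually (\<lambda>x. x < y \<and> c < F x) (at_left y)" by eventually_elim auto
  then show ?thesis using eventually_happens'[OF trivial_limit_at_left_real] by blast
qed

lemma dist_fun_VaR:
  assumes "prob_space P" and "Z \<in> borel_measurable P"
    and cont: "continuous_on UNIV (dist_fun P Z)" and t: "0 < t" "t < 1"
  shows "dist_fun P Z (VaR P Z t) = t"
proof (rule antisym)
  show "t \<le> dist_fun P Z (VaR P Z t)" using VaR_le_iff[OF assms(1,2) t] by auto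
  show "dist_fun P Z (VaR P Z t) \<le> t"
  proof (rule ccontr)
    assume "\<not> ?thesis"
    then obtain x where "x < VaR P Z t" "t < dist_fun P Z x"
      using continuous_on_less_left[OF cont, of t "VaR P Z t"] by auto
    then show False using VaR_le_iff[OF assms(1,2) t, of x] by auto
  qed
qed

lemma continuous_on_dist_fun_iff:
  assumes "prob_space P" and [measurable]: "Z \<in> borel_measurable P"
  shows "continuous_on UNIV (dist_fun P Z) \<longleftrightarrow> (\<forall>x. measure P {\<omega> \<in> space P. Z \<omega> = x} = 0)"
proof -
  interpret cdf_distribution "distr P borel Z" by (rule cdf_distribution_distr[OF assms])
  have "measure (distr P borel Z) {x} = measure P {\<omega> \<in> space P. Z \<omega> = x}" for x
    by (subst measure_distr) (auto intro!: arg_cong[where f = "measure P"])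
  then show ?thesis
    unfolding dist_fun_def by (simp add: continuous_on_eq_continuous_at isCont_cdf)
qed

text \<open>Probability integral transform: \<open>Z\<close> is replaced by its quantile at a
  uniform level, which a continuous distribution function maps back to that level.\<close>

lemma nn_integral_dist_fun:
  fixes h :: "real \<Rightarrow> ennreal"
  assumes "prob_space P" and [measurable]: "Z \<in> borel_measurable P" "h \<in> borel_measurable borel"
    and cont: "continuous_on UNIV (dist_fun P Z)"
  shows "(\<integral>\<^sup>+\<omega>. h (dist_fun P Z (Z \<omega>)) \<partial>P) = (\<integral>\<^sup>+t. h t * indicator {0<..<1} t \<partial>lborel)"
proof -
  note [measurable] = borel_measurable_dist_fun[OF assms(1,2)]
  have "(\<integral>\<^sup>+\<omega>. h (dist_fun P Z (Z \<omega>)) \<partial>P)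
      = (\<integral>\<^sup>+t. h (dist_fun P Z (VaR P Z t)) * indicator {0<..<1} t \<partial>lborel)"
    by (subst nn_integral_VaR[OF assms(1,2)]) auto
  also have "\<dots> = (\<integral>\<^sup>+t. h t * indicator {0<..<1} t \<partial>lborel)"
    by (intro nn_integral_cong) (auto split: split_indicator simp: dist_fun_VaR[OF assms(1,2) cont])
  finally show ?thesis .
qed

lemma AE_dist_fun_in:
  assumes "prob_space P" and [measurable]: "Z \<in> borel_measurable P"
    and cont: "continuous_on UNIV (dist_fun P Z)"
  shows "AE \<omega> in P. dist_fun P Z (Z \<omega>) \<in> {0<..<1}"
    and "AE \<omega> in P. dist_fun P Z (Z \<omega>) \<noteq> t"
proof -
  note [measurable] = borel_measurable_dist_fun[OF assms(1,2)]
  have *: "AE \<omega> in P. dist_fun P Z (Z \<omega>) \<notin> S"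
    if [measurable]: "S \<in> sets borel" and S: "emeasure lborel (S \<inter> {0<..<1}) = 0" for S
  proof -
    have "(\<integral>\<^sup>+\<omega>. indicator S (dist_fun P Z (Z \<omega>)) \<partial>P)
        = (\<integral>\<^sup>+t. indicator (S \<inter> {0<..<1}) t \<partial>lborel)"
      by (subst nn_integral_dist_fun[OF assms(1,2) _ cont])
        (auto simp: indicator_inter_arith[symmetric] intro!: nn_integral_cong split: split_indicator)
    also have "\<dots> = 0" using S by simp
    finally have "AE \<omega> in P. (indicator S (dist_fun P Z (Z \<omega>)) :: ennreal) = 0"
      by (subst (asm) nn_integral_0_iff_AE) auto
    then show ?thesis by eventually_elim (auto split: split_indicator_asm)
  qed
  show "AE \<omega> in P. dist_fun P Z (Z \<omega>) \<in> {0<..<1}" using *[of "- {0<..<1}"] by simp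
  have "emeasure lborel ({t} \<inter> {0<..<1}) \<le> emeasure lborel {t}" by (intro emeasure_mono) auto
  then show "AE \<omega> in P. dist_fun P Z (Z \<omega>) \<noteq> t" using *[of "{t}"] by simp
qed

text \<open>A positive value at 0 would, by continuity, leave mass on the negative half line.
  Consequently every level in (0,1) belongs to \<open>pos_levels\<close>, and \<open>ps_le\<close>
  can be applied at each of them.\<close>

lemma VaR_pos:
  assumes "prob_space P" and [measurable]: "Z \<in> borel_measurable P"
    and cont: "continuous_on UNIV (dist_fun P Z)" and "AE \<omega> in P. 0 \<le> Z \<omega>"
    and t: "0 < t" "t < 1"
  shows "0 < VaR P Z t"
proof (rule ccontr)
  assume "\<not> ?thesis"
  then have "0 < dist_fun P Z 0" using VaR_le_iff[OF assms(1,2) t, of 0] t by auto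
  then obtain x where x: "x < 0" "0 < dist_fun P Z x"
    using continuous_on_less_left[OF cont] by blast
  have "AE \<omega> in P. \<not> Z \<omega> \<le> x" using assms(4) by eventually_elim (use x in auto)
  then have "measure P {\<omega> \<in> space P. Z \<omega> \<le> x} = 0"
    by (simp add: measure_def emeasure_eq_0_AE)
  then show False using x by (simp add: dist_fun_eq)
qed

lemma AE_eq_of_le_of_nn_integral_eq:
  fixes f g :: "'a \<Rightarrow> ennreal"
  assumes [measurable]: "f \<in> borel_measurable M" "g \<in> borel_measurable M"
    and le: "AE x in M. f x \<le> g x" and eq: "integral\<^sup>N M f = integral\<^sup>N M g"
    and fin: "integral\<^sup>N M g < \<top>"
  shows "AE x in M. f x = g x"
proof -
  have "(\<integral>\<^sup>+x. g x - f x \<partial>M) = integral\<^sup>N M g - integral\<^sup>N M f"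
    using fin le by (intro nn_integral_diff) (auto simp: eq)
  also have "\<dots> = 0" using fin by (simp add: eq)
  finally have "AE x in M. g x - f x = 0" by (subst (asm) nn_integral_0_iff_AE) auto
  moreover have "AE x in M. g x \<noteq> \<infinity>" using fin by (intro nn_integral_PInf_AE) auto
  ultimately show ?thesis using le
    by eventually_elim (metis antisym ennreal_minus_eq_0 infinity_ennreal_def)
qed

text \<open>
  The two sides have the same law and one is bounded by the other, hence they agree.
\<close>

lemma AE_VaR_dist_fun:
  assumes "prob_space P" and int: "integrable P Z"
    and cont: "continuous_on UNIV (dist_fun P Z)" and nn: "AE \<omega> in P. 0 \<le> Z \<omega>"
  shows "AE \<omega> in P. VaR P Z (dist_fun P Z (Z \<omega>)) = Z \<omega>"
proof -
  have [measurable]: "Z \<in> borel_measurable P" using int by auto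
  note [measurable] = borel_measurable_dist_fun[OF assms(1) \<open>Z \<in> borel_measurable P\<close>]
  note in01 = AE_dist_fun_in[OF assms(1) \<open>Z \<in> borel_measurable P\<close> cont]
  define a where "a t = (if t \<in> {0<..<1} then VaR P Z t else 0)" for t
  have [measurable]: "a \<in> borel_measurable borel"
    unfolding a_def by (rule borel_measurable_VaR[OF assms(1)]) auto
  have "(\<integral>\<^sup>+\<omega>. ennreal (a (dist_fun P Z (Z \<omega>))) \<partial>P)
      = (\<integral>\<^sup>+t. ennreal (VaR P Z t) * indicator {0<..<1} t \<partial>lborel)"
  proof (subst nn_integral_dist_fun[OF assms(1) _ _ cont])
    show "(\<lambda>t. ennreal (a t)) \<in> borel_measurable borel" by measurable
  qed (auto simp: a_def intro!: nn_integral_cong split: split_indicator)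
  also have "\<dots> = (\<integral>\<^sup>+\<omega>. ennreal (Z \<omega>) \<partial>P)"
    by (subst nn_integral_VaR[OF assms(1)]) auto
  finally have eq: "(\<integral>\<^sup>+\<omega>. ennreal (a (dist_fun P Z (Z \<omega>))) \<partial>P) = (\<integral>\<^sup>+\<omega>. ennreal (Z \<omega>) \<partial>P)" .
  have "AE \<omega> in P. ennreal (a (dist_fun P Z (Z \<omega>))) = ennreal (Z \<omega>)"
  proof (rule AE_eq_of_le_of_nn_integral_eq[OF _ _ _ eq])
    \<comment> \<open>The Galois connection at the point \<open>Z \<omega>\<close> and its own
      level.\<close>
    show "AE \<omega> in P. ennreal (a (dist_fun P Z (Z \<omega>))) \<le> ennreal (Z \<omega>)"
      using in01(1)
    proof eventually_elim
      case (elim \<omega>)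
      then have "VaR P Z (dist_fun P Z (Z \<omega>)) \<le> Z \<omega>"
        by (subst VaR_le_iff[OF assms(1)]) auto
      then show ?case using elim by (auto simp: a_def intro: ennreal_leI)
    qed
    show "(\<integral>\<^sup>+\<omega>. ennreal (Z \<omega>) \<partial>P) < \<top>"
      using nn_integral_eq_integral[OF int nn] by simp
  qed auto
  then show ?thesis using in01(1) nn
  proof eventually_elim
    case (elim \<omega>)
    \<comment> \<open>\<open>ennreal\<close> sends all nonpositive reals to 0; positivity of the
      quantile and nonnegativity of \<open>Z\<close> turn the equation back into one of
      reals.\<close>
    then have "0 < VaR P Z (dist_fun P Z (Z \<omega>))"
      by (intro VaR_pos[OF assms(1) _ cont nn]) auto
    then show ?case using elim by (auto simp: a_def)
  qed
qed

text \<open>The two events can differ only where \<open>Z\<close> exceeds the quantile along a flat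
  piece of its distribution function. There the transform of \<open>Z\<close> equals t, which has
  probability 0.\<close>

lemma AE_VaR_less_iff:
  assumes "prob_space P" and "Z \<in> borel_measurable P"
    and cont: "continuous_on UNIV (dist_fun P Z)" and t: "0 < t" "t < 1"
  shows "AE \<omega> in P. VaR P Z t < Z \<omega> \<longleftrightarrow> t < dist_fun P Z (Z \<omega>)"
  using AE_dist_fun_in(2)[OF assms(1,2) cont, of t]
proof eventually_elim
  case (elim \<omega>)
  have F: "dist_fun P Z (VaR P Z t) = t" by (rule dist_fun_VaR[OF assms])
  have "dist_fun P Z x \<le> dist_fun P Z y" if "x \<le> y" for x y
    using mono_dist_fun[OF assms(1,2)] that by (rule monoD)
  from this[of "VaR P Z t" "Z \<omega>"] this[of "Z \<omega>" "VaR P Z t"] show ?case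
    using elim F by (cases "VaR P Z t < Z \<omega>") auto
qed

lemma measure_VaR_less:
  assumes "prob_space P" and [measurable]: "Z \<in> borel_measurable P"
    and "continuous_on UNIV (dist_fun P Z)" and "0 < t" "t < 1"
  shows "measure P {\<omega> \<in> space P. VaR P Z t < Z \<omega>} = 1 - t"
proof -
  interpret prob_space P by fact
  have "prob {\<omega> \<in> space P. \<not> Z \<omega> \<le> VaR P Z t} = 1 - prob {\<omega> \<in> space P. Z \<omega> \<le> VaR P Z t}"
    by (rule prob_neg) measurable
  then show ?thesis using dist_fun_VaR[OF assms] by (simp add: dist_fun_eq not_le)
qed

text \<open>Both events are upper sets of \<open>Z\<close>, hence nested, and they have the same probability.\<close>

lemma AE_VaR_less_comp_iff:
  assumes "prob_space P" and [measurable]: "Z \<in> borel_measurable P" "\<phi> \<in> borel_measurable borel"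
    and "mono \<phi>"
    and contZ: "continuous_on UNIV (dist_fun P Z)"
    and contV: "continuous_on UNIV (dist_fun P (\<lambda>\<omega>. \<phi> (Z \<omega>)))" and t: "0 < t" "t < 1"
  shows "AE \<omega> in P. VaR P Z t < Z \<omega> \<longleftrightarrow> VaR P (\<lambda>\<omega>. \<phi> (Z \<omega>)) t < \<phi> (Z \<omega>)"
proof -
  interpret prob_space P by fact
  define v w where "v = VaR P Z t" and "w = VaR P (\<lambda>\<omega>. \<phi> (Z \<omega>)) t"
  let ?E = "{\<omega> \<in> space P. v < Z \<omega>}" and ?D = "{\<omega> \<in> space P. w < \<phi> (Z \<omega>)}"
  have meas: "measure P ?E = measure P ?D"
    using measure_VaR_less[OF assms(1) _ contZ t] measure_VaR_less[OF assms(1) _ contV t]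
    by (simp add: v_def w_def)
  have nested: "?E \<subseteq> ?D \<or> ?D \<subseteq> ?E"
  proof (cases "w < \<phi> v")
    case True
    have "?E \<subseteq> ?D"
    proof safe
      fix \<omega> assume "v < Z \<omega>"
      then show "w < \<phi> (Z \<omega>)" using monoD[OF assms(4), of v "Z \<omega>"] True by simp
    qed
    then show ?thesis ..
  next
    case False
    have "?D \<subseteq> ?E"
    proof safe
      fix \<omega> assume "w < \<phi> (Z \<omega>)"
      then show "v < Z \<omega>" using monoD[OF assms(4), of "Z \<omega>" v] False by (cases "v < Z \<omega>") auto
    qed
    then show ?thesis ..
  qed
  have AE: "AE \<omega> in P. \<omega> \<in> S \<longleftrightarrow> \<omega> \<in> R"
    if [measurable]: "S \<in> sets P" "R \<in> sets P" and "S \<subseteq> R" "measure P S = measure P R" for S R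
  proof -
    have "measure P (R - S) = 0" using that by (simp add: finite_measure_Diff)
    then have "R - S \<in> null_sets P" by (intro null_setsI) (auto simp: emeasure_eq_measure)
    from AE_not_in[OF this] show ?thesis by eventually_elim (use that(3) in auto)
  qed
  have "AE \<omega> in P. \<omega> \<in> ?E \<longleftrightarrow> \<omega> \<in> ?D"
    using nested
  proof
    assume "?E \<subseteq> ?D" then show ?thesis by (intro AE) (use meas in auto)
  next
    assume "?D \<subseteq> ?E"
    then have "AE \<omega> in P. \<omega> \<in> ?D \<longleftrightarrow> \<omega> \<in> ?E" by (intro AE) (use meas in auto)
    then show ?thesis by eventually_elim auto
  qed
  with AE_space show ?thesis by eventually_elim (auto simp: v_def w_def)
qed

text \<open>Continuity of the distribution function makes the quantile strictly increasing, so
  \<open>t < s\<close> is an event about the quantile at s and the inverse transform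
  applies.\<close>

lemma nn_integral_upper_VaR:
  assumes "prob_space P" and [measurable]: "Z \<in> borel_measurable P"
    and cont: "continuous_on UNIV (dist_fun P Z)" and t: "0 < t" "t < 1"
  shows "(\<integral>\<^sup>+s. ennreal (VaR P Z s) * indicator {t<..<1} s \<partial>lborel)
    = (\<integral>\<^sup>+\<omega>. ennreal (Z \<omega>) * indicator {\<omega>. VaR P Z t < Z \<omega>} \<omega> \<partial>P)"
proof -
  have "VaR P Z t < VaR P Z s \<longleftrightarrow> t < s" if "s \<in> {0<..<1}" for s
    using VaR_le_iff[OF assms(1,2), of s "VaR P Z t"] dist_fun_VaR[OF assms] that by auto
  then have "(\<integral>\<^sup>+s. ennreal (VaR P Z s) * indicator {t<..<1} s \<partial>lborel)
    = (\<integral>\<^sup>+s. (ennreal (VaR P Z s) * indicator {VaR P Z t<..} (VaR P Z s)) * indicator {0<..<1} s \<partial>lborel)"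
    using t by (intro nn_integral_cong) (auto split: split_indicator)
  also have "\<dots> = (\<integral>\<^sup>+\<omega>. ennreal (Z \<omega>) * indicator {VaR P Z t<..} (Z \<omega>) \<partial>P)"
    by (subst nn_integral_VaR[OF assms(1,2)]) auto
  finally show ?thesis by (simp add: indicator_def)
qed

text \<open>With v the quantile at t, \<open>v * (max 0 ((Z - v) / v) + 1)\<close> is
  \<open>Z\<close> on the event \<open>v < Z\<close>, while off it the positive part vanishes. The
  event has probability \<open>1 - t\<close>, so integration gives the identity.\<close>

lemma upper_VaR_integral_eq_EPS:
  assumes "prob_space P" and int: "integrable P Z"
    and cont: "continuous_on UNIV (dist_fun P Z)" and nn: "AE \<omega> in P. 0 \<le> Z \<omega>" and t: "0 < t" "t < 1"
  shows "(\<integral>\<^sup>+s. ennreal (VaR P Z s) * indicator {t<..<1} s \<partial>lborel)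
    = ennreal (VaR P Z t * (EPS P Z t + (1 - t)))"
    and "0 \<le> EPS P Z t"
proof -
  interpret prob_space P by fact
  have [measurable]: "Z \<in> borel_measurable P" using int by auto
  define v where "v = VaR P Z t"
  have v: "0 < v" unfolding v_def by (rule VaR_pos[OF assms(1) _ cont nn t]) simp
  show E0: "0 \<le> EPS P Z t" by (auto simp: EPS_def intro!: integral_nonneg_AE)
  have "ennreal (EPS P Z t) = (\<integral>\<^sup>+\<omega>. ennreal (max 0 ((Z \<omega> - v) / v)) \<partial>P)"
    unfolding EPS_def v_def[symmetric] using int
    by (intro nn_integral_eq_integral[symmetric]) (auto intro!: integrable_max)
  moreover have "ennreal (1 - t) = (\<integral>\<^sup>+\<omega>. indicator {\<omega>. v < Z \<omega>} \<omega> \<partial>P)"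
  proof -
    have "(\<integral>\<^sup>+\<omega>. indicator {\<omega>. v < Z \<omega>} \<omega> \<partial>P) = (\<integral>\<^sup>+\<omega>. indicator {\<omega> \<in> space P. v < Z \<omega>} \<omega> \<partial>P)"
      by (intro nn_integral_cong) (auto split: split_indicator)
    then show ?thesis
      using measure_VaR_less[OF assms(1) _ cont t] by (simp add: v_def[symmetric] emeasure_eq_measure)
  qed
  ultimately have "ennreal (EPS P Z t) + ennreal (1 - t)
      = (\<integral>\<^sup>+\<omega>. ennreal (max 0 ((Z \<omega> - v) / v)) + indicator {\<omega>. v < Z \<omega>} \<omega> \<partial>P)"
    by (simp add: nn_integral_add)
  then have "ennreal v * (ennreal (EPS P Z t) + ennreal (1 - t))
      = (\<integral>\<^sup>+\<omega>. ennreal v * (ennreal (max 0 ((Z \<omega> - v) / v)) + indicator {\<omega>. v < Z \<omega>} \<omega>) \<partial>P)"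
    by (simp add: nn_integral_cmult)
  also have "\<dots> = (\<integral>\<^sup>+\<omega>. ennreal (Z \<omega>) * indicator {\<omega>. v < Z \<omega>} \<omega> \<partial>P)"
  proof (intro nn_integral_cong)
    fix \<omega>
    show "ennreal v * (ennreal (max 0 ((Z \<omega> - v) / v)) + indicator {\<omega>. v < Z \<omega>} \<omega>)
        = ennreal (Z \<omega>) * indicator {\<omega>. v < Z \<omega>} \<omega>"
    proof (cases "v < Z \<omega>")
      case True
      have "ennreal v * (ennreal (max 0 ((Z \<omega> - v) / v)) + 1) = ennreal (v * ((Z \<omega> - v) / v + 1))"
        using True v by (simp add: ennreal_mult ennreal_plus max_def)
      then show ?thesis using True v by (simp add: field_simps)
    next
      case False
      then have "(Z \<omega> - v) / v \<le> 0" using v by (intro divide_nonpos_pos) auto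
      then show ?thesis using False by (simp add: max_absorb1)
    qed
  qed
  also have "\<dots> = (\<integral>\<^sup>+s. ennreal (VaR P Z s) * indicator {t<..<1} s \<partial>lborel)"
    unfolding v_def by (rule nn_integral_upper_VaR[symmetric, OF assms(1) _ cont t]) simp
  finally show "(\<integral>\<^sup>+s. ennreal (VaR P Z s) * indicator {t<..<1} s \<partial>lborel)
    = ennreal (VaR P Z t * (EPS P Z t + (1 - t)))"
    using v E0 t by (simp add: v_def[symmetric] ennreal_mult ennreal_plus)
qed

section \<open>Copulas and stress events\<close>

declare One_nat_def [simp del]

text \<open>Stress can be read off the transformed components alone, which is why conditioning on it
  involves only the copula.\<close>

lemma stress_event_copula:
  fixes U :: "nat \<Rightarrow> 'a \<Rightarrow> real"
  assumes "prob_space M" and meas: "\<And>i. i \<in> {1..n} \<Longrightarrow> X i \<in> borel_measurable M"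
    and cont: "\<And>i. i \<in> {1..n} \<Longrightarrow> continuous_on UNIV (dist_fun M (X i))"
    and q: "\<And>j. j \<in> {2..n} \<Longrightarrow> 0 < q j \<and> q j < 1"
  shows "AE \<omega> in M. \<omega> \<in> stress_event n M X q \<longleftrightarrow> (\<forall>j\<in>{2..n}. q j < dist_fun M (X j) (X j \<omega>))"
    and "stress_event n M X q \<in> sets M"
proof -
  have "AE \<omega> in M. \<forall>j\<in>{2..n}. VaR M (X j) (q j) < X j \<omega> \<longleftrightarrow> q j < dist_fun M (X j) (X j \<omega>)"
    using q by (intro AE_finite_allI AE_VaR_less_iff[OF assms(1)] meas cont) auto
  with AE_space show "AE \<omega> in M. \<omega> \<in> stress_event n M X q \<longleftrightarrow> (\<forall>j\<in>{2..n}. q j < dist_fun M (X j) (X j \<omega>))"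
    by eventually_elim (auto simp: stress_event_def)
  have "{\<omega> \<in> space M. VaR M (X j) (q j) < X j \<omega>} \<in> sets M" if "j \<in> {2..n}" for j
  proof -
    have [measurable]: "X j \<in> borel_measurable M" using that by (intro meas) auto
    show ?thesis by measurable
  qed
  then show "stress_event n M X q \<in> sets M"
    unfolding stress_event_def by (intro sets.sets_Collect_finite_All) auto
qed

definition copula_law :: "nat \<Rightarrow> 'a measure \<Rightarrow> (nat \<Rightarrow> 'a \<Rightarrow> real) \<Rightarrow> (nat \<Rightarrow> real) measure" where
  "copula_law n M X = distr M (Pi\<^sub>M {1..n} (\<lambda>_. borel)) (rvec n (\<lambda>i \<omega>. dist_fun M (X i) (X i \<omega>)))"

text \<open>The stress event in copula coordinates, with coordinate 1 left free. The levels may be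
  negative: for levels -1 the box contains every value of the transformed vector and stands for the
  absence of stress.\<close>

definition upper_box :: "nat \<Rightarrow> (nat \<Rightarrow> real) \<Rightarrow> (nat \<Rightarrow> real) set" where
  "upper_box n q = {v \<in> {1..n} \<rightarrow>\<^sub>E UNIV. \<forall>j\<in>{2..n}. q j < v j}"

lemma upper_box_sets: "upper_box n q \<in> sets (Pi\<^sub>M {1..n} (\<lambda>_. borel))"
proof -
  have "{v \<in> space (Pi\<^sub>M {1..n} (\<lambda>_. borel)). \<forall>j\<in>{2..n}. q j < v j} \<in> sets (Pi\<^sub>M {1..n} (\<lambda>_. borel :: real measure))"
  proof (rule sets.sets_Collect_finite_All)
    fix j assume "j \<in> {2..n}"
    then have [measurable]: "(\<lambda>v. v j) \<in> borel_measurable (Pi\<^sub>M {1..n} (\<lambda>_. borel :: real measure))"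
      by (intro measurable_component_singleton) auto
    show "{v \<in> space (Pi\<^sub>M {1..n} (\<lambda>_. borel)). q j < v j} \<in> sets (Pi\<^sub>M {1..n} (\<lambda>_. borel :: real measure))"
      by measurable
  qed simp
  then show ?thesis by (simp add: upper_box_def space_PiM)
qed

lemma measurable_copula_map:
  assumes "prob_space M" and "\<And>i. i \<in> {1..n} \<Longrightarrow> X i \<in> borel_measurable M"
  shows "rvec n (\<lambda>i \<omega>. dist_fun M (X i) (X i \<omega>)) \<in> measurable M (Pi\<^sub>M {1..n} (\<lambda>_. borel))"
  unfolding rvec_def
  using assms borel_measurable_dist_fun[OF assms(1)]
  by (intro measurable_restrict) (auto intro: measurable_compose)

text \<open>
  \<open>X 1\<close> is a nondecreasing function of \<open>U 1 = F 1 (X 1)\<close> almost surely, so its expected shortfall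
  given the stress event is an integral of the quantile function of \<open>X 1\<close> against the copula; the
  threshold is the conditional quantile of \<open>U 1\<close>, which depends on the copula only.
\<close>

lemma MCoES_eq_copula_integral:
  fixes n M X q
  defines "\<mu> \<equiv> copula_law n M X"
  defines "Q \<equiv> VaR (uniform_measure \<mu> (upper_box n q)) (\<lambda>v. v 1) (q 1)"
  assumes "prob_space M" and n: "1 \<le> n" and meas: "\<And>i. i \<in> {1..n} \<Longrightarrow> X i \<in> borel_measurable M"
    and cont: "\<And>i. i \<in> {1..n} \<Longrightarrow> continuous_on UNIV (dist_fun M (X i))"
    and int: "integrable M (X 1)" and nn: "AE \<omega> in M. 0 \<le> X 1 \<omega>"
    and q: "\<And>i. i \<in> {1..n} \<Longrightarrow> 0 < q i \<and> q i < 1"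
    and pos: "0 < measure M (stress_event n M X q)"
  shows "MCoES n M X q = enn2real ((\<integral>\<^sup>+v. ennreal (if v 1 \<in> {0<..<1} then VaR M (X 1) (v 1) else 0)
      * indicator {Q<..} (v 1) * indicator (upper_box n q) v \<partial>\<mu>) / emeasure \<mu> (upper_box n q)) / (1 - q 1)"
    and "emeasure \<mu> (upper_box n q) = ennreal (measure M (stress_event n M X q))"
proof -
  interpret prob_space M by fact
  define A where "A = stress_event n M X q"
  define P where "P = uniform_measure M A"
  define U where "U i \<omega> = dist_fun M (X i) (X i \<omega>)" for i \<omega>
  have q': "0 < q j \<and> q j < 1" if "j \<in> {2..n}" for j using q[of j] that by auto
  note stress = stress_event_copula[OF assms(3) meas cont q']
  have A_AE: "AE \<omega> in M. \<omega> \<in> A \<longleftrightarrow> (\<forall>j\<in>{2..n}. q j < U j \<omega>)"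
    unfolding A_def U_def by (rule stress(1))
  have A_sets [measurable]: "A \<in> sets M" unfolding A_def by (rule stress(2))
  have A_pos: "0 < measure M A" using pos by (simp add: A_def)
  have A_ne: "emeasure M A \<noteq> 0" "emeasure M A \<noteq> \<infinity>"
    using A_pos by (auto simp: emeasure_eq_measure)
  have one: "1 \<in> {1..n}" using n by auto
  note [measurable] = meas[OF one] borel_measurable_dist_fun[OF assms(3) meas[OF one]]
  note contX = cont[OF one]
  have q1: "0 < q 1" "q 1 < 1" using q[OF one] by auto
  have V[measurable]: "rvec n U \<in> measurable M (Pi\<^sub>M {1..n} (\<lambda>_. borel))"
    unfolding U_def by (rule measurable_copula_map[OF assms(3) meas])
  have \<mu>: "\<mu> = distr M (Pi\<^sub>M {1..n} (\<lambda>_. borel)) (rvec n U)" by (simp add: \<mu>_def copula_law_def U_def[abs_def])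
  note [measurable] = upper_box_sets[of n q]
  have box: "rvec n U \<omega> \<in> upper_box n q \<longleftrightarrow> (\<forall>j\<in>{2..n}. q j < U j \<omega>)" for \<omega>
    by (auto simp: upper_box_def rvec_def)
  have V1: "rvec n U \<omega> 1 = U 1 \<omega>" for \<omega> using n by (simp add: rvec_def)
  have AEP: "AE \<omega> in P. R \<omega>" if "AE \<omega> in M. R \<omega>" for R
    unfolding P_def using that by (intro AE_uniform_measureI) auto
  interpret P: prob_space P unfolding P_def using A_ne by (rule prob_space_uniform_measure)
  have U_meas [measurable]: "U 1 \<in> borel_measurable M" unfolding U_def by measurable
  have setsP: "sets P = sets M" by (simp add: P_def)
  have measP [measurable]: "X 1 \<in> borel_measurable P" "U 1 \<in> borel_measurable P"
    unfolding measurable_cong_sets[OF setsP refl] by (rule meas[OF one] U_meas)+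
  \<comment> \<open>Conditioning on an event of positive probability preserves null sets, so it
    creates no atoms; quantiles under \<open>P\<close> thus obey the lemmas for continuous
    laws.\<close>
  have contP: "continuous_on UNIV (dist_fun P (X 1))"
  proof (subst continuous_on_dist_fun_iff[OF P.prob_space_axioms measP(1)], rule allI)
    fix x
    have "measure M {\<omega> \<in> space M. X 1 \<omega> = x} = 0"
      using contX by (subst (asm) continuous_on_dist_fun_iff[OF assms(3) meas[OF one]]) auto
    then have "AE \<omega> in M. X 1 \<omega> \<noteq> x"
      by (subst AE_iff_measurable[OF _ refl]) (auto simp: emeasure_eq_measure)
    then have "AE \<omega> in P. X 1 \<omega> \<noteq> x" by (rule AEP)
    then show "measure P {\<omega> \<in> space P. X 1 \<omega> = x} = 0" by (simp add: measure_def emeasure_eq_0_AE)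
  qed
  have contU: "continuous_on UNIV (dist_fun P (U 1))"
  proof (subst continuous_on_dist_fun_iff[OF P.prob_space_axioms measP(2)], rule allI)
    fix x
    have "AE \<omega> in M. U 1 \<omega> \<noteq> x" unfolding U_def by (rule AE_dist_fun_in(2)[OF assms(3) _ contX]) simp
    then have "AE \<omega> in P. U 1 \<omega> \<noteq> x" by (rule AEP)
    then show "measure P {\<omega> \<in> space P. U 1 \<omega> = x} = 0" by (simp add: measure_def emeasure_eq_0_AE)
  qed
  have emu: "emeasure \<mu> (upper_box n q) = emeasure M A"
    unfolding \<mu> using A_AE by (subst emeasure_distr) (auto intro!: emeasure_eq_AE simp: box)
  then show "emeasure \<mu> (upper_box n q) = ennreal (measure M (stress_event n M X q))"
    by (simp add: A_def emeasure_eq_measure)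
  have Q: "Q = VaR P (U 1) (q 1)"
  proof -
    have "dist_fun (uniform_measure \<mu> (upper_box n q)) (\<lambda>v. v 1) x = dist_fun P (U 1) x" for x
    proof -
      have [measurable]: "(\<lambda>v. v 1) \<in> borel_measurable (Pi\<^sub>M {1..n} (\<lambda>_. borel :: real measure))"
        using one by measurable
      have "dist_fun (uniform_measure \<mu> (upper_box n q)) (\<lambda>v. v 1) x
          = measure (uniform_measure \<mu> (upper_box n q)) {v \<in> space \<mu>. v 1 \<le> x}"
        by (subst dist_fun_eq) (auto simp: \<mu> cong: measurable_cong_sets)
      also have "\<dots> = measure \<mu> (upper_box n q \<inter> {v \<in> space \<mu>. v 1 \<le> x}) / measure \<mu> (upper_box n q)"
        using emu A_ne by (intro measure_uniform_measure) (auto simp: \<mu>)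
      also have "measure \<mu> (upper_box n q) = measure M A" using emu by (simp add: measure_def)
      also have "measure \<mu> (upper_box n q \<inter> {v \<in> space \<mu>. v 1 \<le> x}) = measure M (A \<inter> {\<omega> \<in> space M. U 1 \<omega> \<le> x})"
      proof -
        have "measure \<mu> (upper_box n q \<inter> {v \<in> space \<mu>. v 1 \<le> x})
            = measure M (rvec n U -` (upper_box n q \<inter> {v \<in> space \<mu>. v 1 \<le> x}) \<inter> space M)"
          unfolding \<mu> by (subst measure_distr) auto
        also have "\<dots> = measure M (A \<inter> {\<omega> \<in> space M. U 1 \<omega> \<le> x})"
          using A_AE measurable_space[OF V]
          by (intro finite_measure_eq_AE) (auto simp: box V1 \<mu> elim!: eventually_mono)
        finally show ?thesis .
      qed
      also have "measure M (A \<inter> {\<omega> \<in> space M. U 1 \<omega> \<le> x}) / measure M A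
          = measure P {\<omega> \<in> space M. U 1 \<omega> \<le> x}"
        unfolding P_def using A_ne by (intro measure_uniform_measure[symmetric]) auto
      also have "\<dots> = dist_fun P (U 1) x"
        by (subst dist_fun_eq) (auto simp: P_def cong: measurable_cong_sets)
      finally show ?thesis .
    qed
    then show ?thesis unfolding Q_def VaR_def by simp
  qed
  \<comment> \<open>The stress event reads only the levels with index at least 2, so integrating
    over the first level keeps \<open>P\<close> fixed.\<close>
  have CoVaR: "MCoVaR n M X (q(1 := t)) = VaR P (X 1) t" for t
  proof -
    have "stress_event n M X (q(1 := t)) = A" by (auto simp: stress_event_def A_def)
    then show ?thesis by (simp add: MCoVaR_def P_def)
  qed
  have "(LINT t:{q 1<..<1}|lborel. MCoVaR n M X (q(1 := t)))
      = (\<integral>t. (if t \<in> {0<..<1} then VaR P (X 1) t else 0) * indicator {q 1<..<1} t \<partial>lborel)"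
    unfolding set_lebesgue_integral_def CoVaR using q1
    by (intro Bochner_Integration.integral_cong) (auto split: split_indicator)
  also have "\<dots> = enn2real (\<integral>\<^sup>+t. ennreal ((if t \<in> {0<..<1} then VaR P (X 1) t else 0) * indicator {q 1<..<1} t) \<partial>lborel)"
  proof (rule integral_eq_nn_integral)
    note [measurable] = borel_measurable_VaR[OF P.prob_space_axioms measP(1)]
    show "(\<lambda>t. (if t \<in> {0<..<1} then VaR P (X 1) t else 0) * indicator {q 1<..<1} t) \<in> borel_measurable lborel"
      by measurable
    show "AE t in lborel. 0 \<le> (if t \<in> {0<..<1} then VaR P (X 1) t else 0) * indicator {q 1<..<1} t"
      using VaR_pos[OF P.prob_space_axioms measP(1) contP AEP[OF nn]]
      by (auto split: split_indicator intro: less_imp_le)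
  qed
  also have "(\<integral>\<^sup>+t. ennreal ((if t \<in> {0<..<1} then VaR P (X 1) t else 0) * indicator {q 1<..<1} t) \<partial>lborel)
      = (\<integral>\<^sup>+t. ennreal (VaR P (X 1) t) * indicator {q 1<..<1} t \<partial>lborel)"
    using q1 by (intro nn_integral_cong) (auto split: split_indicator)
  also have "\<dots> = (\<integral>\<^sup>+\<omega>. ennreal (X 1 \<omega>) * indicator {\<omega>. VaR P (X 1) (q 1) < X 1 \<omega>} \<omega> \<partial>P)"
    by (rule nn_integral_upper_VaR[OF P.prob_space_axioms measP(1) contP q1])
  \<comment> \<open>The threshold moves from \<open>X 1\<close> to \<open>U 1\<close>. The monotone
    map is the distribution function under \<open>M\<close>, while both quantiles are taken under
    \<open>P\<close>.\<close>
  also have "\<dots> = (\<integral>\<^sup>+\<omega>. ennreal (X 1 \<omega>) * indicator {Q<..} (U 1 \<omega>) \<partial>P)"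
  proof (rule nn_integral_cong_AE)
    have "AE \<omega> in P. VaR P (X 1) (q 1) < X 1 \<omega>
        \<longleftrightarrow> VaR P (\<lambda>\<omega>. dist_fun M (X 1) (X 1 \<omega>)) (q 1) < dist_fun M (X 1) (X 1 \<omega>)"
      using contU unfolding U_def
      by (intro AE_VaR_less_comp_iff[OF P.prob_space_axioms measP(1) _ mono_dist_fun[OF assms(3)] contP _ q1]) auto
    then show "AE \<omega> in P. ennreal (X 1 \<omega>) * indicator {\<omega>. VaR P (X 1) (q 1) < X 1 \<omega>} \<omega>
        = ennreal (X 1 \<omega>) * indicator {Q<..} (U 1 \<omega>)"
      by eventually_elim (auto simp: Q U_def[abs_def] split: split_indicator)
  qed
  also have "\<dots> = (\<integral>\<^sup>+\<omega>. ennreal (X 1 \<omega>) * indicator {Q<..} (U 1 \<omega>) * indicator A \<omega> \<partial>M) / emeasure M A"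
    unfolding P_def by (rule nn_integral_uniform_measure) measurable
  also have "(\<integral>\<^sup>+\<omega>. ennreal (X 1 \<omega>) * indicator {Q<..} (U 1 \<omega>) * indicator A \<omega> \<partial>M)
      = (\<integral>\<^sup>+\<omega>. ennreal (if U 1 \<omega> \<in> {0<..<1} then VaR M (X 1) (U 1 \<omega>) else 0)
          * indicator {Q<..} (U 1 \<omega>) * indicator (upper_box n q) (rvec n U \<omega>) \<partial>M)"
  proof (rule nn_integral_cong_AE)
    show "AE \<omega> in M. ennreal (X 1 \<omega>) * indicator {Q<..} (U 1 \<omega>) * indicator A \<omega>
      = ennreal (if U 1 \<omega> \<in> {0<..<1} then VaR M (X 1) (U 1 \<omega>) else 0)
          * indicator {Q<..} (U 1 \<omega>) * indicator (upper_box n q) (rvec n U \<omega>)"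
      using AE_dist_fun_in(1)[OF assms(3) meas[OF one] contX] AE_VaR_dist_fun[OF assms(3) int contX nn] A_AE
      by eventually_elim (auto simp: box U_def split: split_indicator)
  qed
  also have "\<dots> = (\<integral>\<^sup>+v. ennreal (if v 1 \<in> {0<..<1} then VaR M (X 1) (v 1) else 0)
          * indicator {Q<..} (v 1) * indicator (upper_box n q) v \<partial>\<mu>)"
  proof -
    have [measurable]: "(\<lambda>v. v 1) \<in> borel_measurable (Pi\<^sub>M {1..n} (\<lambda>_. borel :: real measure))"
      using one by measurable
    have [measurable]: "(\<lambda>v. (if v 1 \<in> {0<..<1} then VaR M (X 1) (v 1) else 0)) \<in> borel_measurable (Pi\<^sub>M {1..n} (\<lambda>_. borel :: real measure))"
      by (rule measurable_compose[OF _ borel_measurable_VaR[OF assms(3) meas[OF one]]]) measurable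
    have "(\<lambda>v. ennreal (if v 1 \<in> {0<..<1} then VaR M (X 1) (v 1) else 0)
        * indicator {Q<..} (v 1) * indicator (upper_box n q) v) \<in> borel_measurable (Pi\<^sub>M {1..n} (\<lambda>_. borel))"
      by (intro borel_measurable_times_ennreal measurable_compose[OF _ measurable_ennreal]) measurable
    from nn_integral_distr[OF V, of "\<lambda>v. ennreal (if v 1 \<in> {0<..<1} then VaR M (X 1) (v 1) else 0)
        * indicator {Q<..} (v 1) * indicator (upper_box n q) v"] this
    show ?thesis by (simp only: \<mu> V1 measurable_distr_eq1)
  qed
  finally show "MCoES n M X q = enn2real ((\<integral>\<^sup>+v. ennreal (if v 1 \<in> {0<..<1} then VaR M (X 1) (v 1) else 0)
      * indicator {Q<..} (v 1) * indicator (upper_box n q) v \<partial>\<mu>) / emeasure \<mu> (upper_box n q)) / (1 - q 1)"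
    unfolding MCoES_def emu by (simp only: times_divide_eq_left mult_1_left)
qed

text \<open>Lower orthants are closed under intersection, generate the product sigma-algebra and
  exhaust the space along the diagonal: the uniqueness theorem for joint distribution
  functions.\<close>

lemma measure_eqI_orthants:
  fixes \<mu> \<nu> :: "('i \<Rightarrow> real) measure"
  assumes "finite I" and sets: "sets \<mu> = sets (Pi\<^sub>M I (\<lambda>_. borel))" "sets \<nu> = sets (Pi\<^sub>M I (\<lambda>_. borel))"
    and "finite_measure \<mu>"
    and eq: "\<And>u. emeasure \<mu> {v \<in> I \<rightarrow>\<^sub>E UNIV. \<forall>i\<in>I. v i \<le> u i} = emeasure \<nu> {v \<in> I \<rightarrow>\<^sub>E UNIV. \<forall>i\<in>I. v i \<le> u i}"
  shows "\<mu> = \<nu>"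
proof -
  interpret finite_measure \<mu> by fact
  define Orth where "Orth u = {v \<in> I \<rightarrow>\<^sub>E (UNIV :: real set). \<forall>i\<in>I. v i \<le> u i}" for u
  have "sets (Pi\<^sub>M I (\<lambda>_. borel :: real measure))
      = sets (Pi\<^sub>M I (\<lambda>_. sigma UNIV (range (\<lambda>a::real. {..a}))))"
    by (subst borel_eq_atMost) simp
  also have "\<dots> = sets (sigma (I \<rightarrow>\<^sub>E UNIV)
      {{f \<in> I \<rightarrow>\<^sub>E UNIV. \<forall>i\<in>j. f i \<in> A i} |A j. j \<in> {I} \<and> A \<in> Pi j (\<lambda>_. range (\<lambda>a::real. {..a}))})"
  proof (rule sets_PiM_sigma)
    show "\<exists>S\<subseteq>range (\<lambda>a::real. {..a}). countable S \<and> UNIV = \<Union>S"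
      by (intro exI[of _ "range (\<lambda>k::nat. {..real k})"]) (auto intro: real_arch_simple)
  qed (use assms(1) in auto)
  also have "{{f \<in> I \<rightarrow>\<^sub>E UNIV. \<forall>i\<in>j. f i \<in> A i} |A j. j \<in> {I} \<and> A \<in> Pi j (\<lambda>_. range (\<lambda>a::real. {..a}))} = range Orth"
  proof safe
    fix A :: "'i \<Rightarrow> real set" and j assume "A \<in> Pi I (\<lambda>_. range (\<lambda>a::real. {..a}))"
    then have "\<forall>i\<in>I. \<exists>a. A i = {..a}" by auto
    then obtain u where "\<forall>i\<in>I. A i = {..u i}" by metis
    then show "{f \<in> I \<rightarrow>\<^sub>E UNIV. \<forall>i\<in>I. f i \<in> A i} \<in> range Orth"
      by (intro image_eqI[of _ _ u]) (auto simp: Orth_def)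
  next
    fix u
    show "\<exists>A j. Orth u = {f \<in> I \<rightarrow>\<^sub>E UNIV. \<forall>i\<in>j. f i \<in> A i} \<and> j \<in> {I} \<and> A \<in> Pi j (\<lambda>_. range (\<lambda>a::real. {..a}))"
      by (intro exI[of _ "\<lambda>i. {..u i}"] exI[of _ I]) (auto simp: Orth_def)
  qed
  finally have gen: "sets (Pi\<^sub>M I (\<lambda>_. borel :: real measure)) = sigma_sets (I \<rightarrow>\<^sub>E UNIV) (range Orth)"
    by (subst (asm) sets_measure_of) (auto simp: Orth_def)
  show ?thesis
  proof (rule measure_eqI_generator_eq)
    show "Int_stable (range Orth)"
    proof (rule Int_stableI)
      fix a b assume "a \<in> range Orth" "b \<in> range Orth"
      then obtain u w where "a = Orth u" "b = Orth w" by auto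
      then have "a \<inter> b = Orth (\<lambda>i. min (u i) (w i))" by (auto simp: Orth_def)
      then show "a \<inter> b \<in> range Orth" by auto
    qed
    show "range Orth \<subseteq> Pow (I \<rightarrow>\<^sub>E UNIV)" by (auto simp: Orth_def)
    show "emeasure \<mu> X = emeasure \<nu> X" if "X \<in> range Orth" for X using that eq by (auto simp: Orth_def)
    show "range (\<lambda>k. Orth (\<lambda>_. real k)) \<subseteq> range Orth" by auto
    show "(\<Union>k. Orth (\<lambda>_. real k)) = (I \<rightarrow>\<^sub>E UNIV)"
    proof safe
      fix v :: "'i \<Rightarrow> real" assume v: "v \<in> I \<rightarrow>\<^sub>E UNIV"
      obtain k where k: "(\<Sum>i\<in>I. \<bar>v i\<bar>) \<le> real k" using real_arch_simple by blast
      have "v i \<le> real k" if "i \<in> I" for i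
        using member_le_sum[of i I "\<lambda>i. \<bar>v i\<bar>"] assms(1) that k by auto
      then show "v \<in> (\<Union>k. Orth (\<lambda>_. real k))" using v by (auto simp: Orth_def)
    qed (auto simp: Orth_def)
  qed (auto simp: sets gen)
qed

text \<open>\<open>C\<close> prescribes the law only for corners in the unit cube. Its value at
  (1,...,1) is 1, so coordinates above 1 may be cut to 1. An orthant with a negative coordinate is,
  up to a null set, inside the one with 0 there and 1 elsewhere, which is null because each
  transformed component is positive almost surely.\<close>

lemma copula_law_eq:
  assumes "prob_space M" and meas: "\<And>i. i \<in> {1..n} \<Longrightarrow> X i \<in> borel_measurable M"
    and cont: "\<And>i. i \<in> {1..n} \<Longrightarrow> continuous_on UNIV (dist_fun M (X i))"
    and cop: "is_copula_of n M X C"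
    and "prob_space \<mu>" and sets: "sets \<mu> = sets (Pi\<^sub>M {1..n} (\<lambda>_. borel))"
    and \<mu>C: "\<And>u. u \<in> {1..n} \<rightarrow>\<^sub>E {0..1} \<Longrightarrow> measure \<mu> {v \<in> space \<mu>. \<forall>i\<in>{1..n}. v i \<le> u i} = C u"
  shows "copula_law n M X = \<mu>"
proof -
  interpret M: prob_space M by fact
  interpret \<mu>: prob_space \<mu> by fact
  define U where "U i \<omega> = dist_fun M (X i) (X i \<omega>)" for i \<omega>
  define Orth where "Orth u = {v \<in> {1..n} \<rightarrow>\<^sub>E (UNIV :: real set). \<forall>i\<in>{1..n}. v i \<le> u i}" for u
  define D where "D u = {\<omega> \<in> space M. \<forall>i\<in>{1..n}. U i \<omega> \<le> u i}" for u
  have space: "space \<mu> = {1..n} \<rightarrow>\<^sub>E UNIV" using sets_eq_imp_space_eq[OF sets] by (simp add: space_PiM)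
  have Orth_sets[measurable]: "Orth u \<in> sets (Pi\<^sub>M {1..n} (\<lambda>_. borel))" for u
  proof -
    have "{v \<in> space (Pi\<^sub>M {1..n} (\<lambda>_. borel)). \<forall>i\<in>{1..n}. v i \<le> u i} \<in> sets (Pi\<^sub>M {1..n} (\<lambda>_. borel :: real measure))"
      by (intro sets.sets_Collect_finite_All) auto
    then show ?thesis by (simp add: Orth_def space_PiM)
  qed
  have V[measurable]: "rvec n U \<in> measurable M (Pi\<^sub>M {1..n} (\<lambda>_. borel))"
    unfolding U_def by (rule measurable_copula_map[OF assms(1) meas])
  have VO: "rvec n U -` Orth u \<inter> space M = D u" for u
    by (auto simp: Orth_def D_def rvec_def)
  have D_sets: "D u \<in> sets M" for u unfolding VO[symmetric] using V by (rule measurable_sets) simp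
  have C: "measure \<mu> (Orth u) = measure M (D u)" if "u \<in> {1..n} \<rightarrow>\<^sub>E {0..1}" for u
    using \<mu>C[OF that] cop that by (auto simp: is_copula_of_def Orth_def D_def U_def space)
  have U01: "0 \<le> U i \<omega>" "U i \<omega> \<le> 1" if "i \<in> {1..n}" for i \<omega>
    unfolding U_def by (auto simp: dist_fun_eq[OF meas[OF that]])
  have cube: "AE v in \<mu>. \<forall>i\<in>{1..n}. v i \<le> 1"
  proof -
    have "measure \<mu> (Orth (\<lambda>i\<in>{1..n}. 1)) = measure M (D (\<lambda>i\<in>{1..n}. 1))" by (rule C) auto
    also have "D (\<lambda>i\<in>{1..n}. 1) = space M" using U01 by (auto simp: D_def)
    finally have "AE v in \<mu>. v \<in> Orth (\<lambda>i\<in>{1..n}. 1)"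
      by (intro \<mu>.AE_prob_1) (simp only: M.prob_space)
    then show ?thesis by eventually_elim (auto simp: Orth_def)
  qed
  have main: "measure \<mu> (Orth u) = measure M (D u)" for u
  proof (cases "\<forall>i\<in>{1..n}. 0 \<le> u i")
    case True
    let ?u = "\<lambda>i\<in>{1..n}. min 1 (u i)"
    have "measure \<mu> (Orth u) = measure \<mu> (Orth ?u)"
      using cube by (intro \<mu>.finite_measure_eq_AE) (auto simp: sets Orth_def elim!: eventually_mono intro!: Orth_sets[unfolded Orth_def])
    also have "\<dots> = measure M (D ?u)" using True by (intro C) auto
    also have "D ?u = D u" using U01 by (auto simp: D_def)
    finally show ?thesis .
  next
    case False
    then obtain i where i: "i \<in> {1..n}" "u i < 0" by auto
    have "D u = {}"
    proof -
      have False if "\<omega> \<in> D u" for \<omega>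
        using that i U01(1)[OF i(1), of \<omega>] by (auto simp: D_def dest!: bspec[OF _ i(1)])
      then show ?thesis by blast
    qed
    let ?u = "\<lambda>j\<in>{1..n}. if j = i then 0 else 1 :: real"
    have "measure \<mu> (Orth u) \<le> measure \<mu> (Orth ?u)"
    proof (rule \<mu>.finite_measure_mono_AE)
      show "AE v in \<mu>. v \<in> Orth u \<longrightarrow> v \<in> Orth ?u"
        using cube by eventually_elim (use i in \<open>force simp: Orth_def\<close>)
    qed (simp add: sets)
    also have "\<dots> = measure M (D ?u)" by (intro C) auto
    also have "\<dots> = 0"
    proof -
      have "AE \<omega> in M. \<omega> \<notin> D ?u"
        using AE_dist_fun_in(1)[OF assms(1) meas cont, OF i(1) i(1)]
        by eventually_elim (use i in \<open>force simp: D_def U_def\<close>)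
      then have "D ?u \<in> null_sets M" using D_sets by (subst AE_iff_null_sets) auto
      then show ?thesis by (simp add: measure_def null_setsD1)
    qed
    finally show ?thesis using \<open>D u = {}\<close> by (simp add: antisym)
  qed
  show ?thesis
  proof (rule measure_eqI_orthants[of "{1..n}"])
    show "finite_measure (copula_law n M X)"
      unfolding copula_law_def using V unfolding U_def by (rule M.finite_measure_distr)
    fix u
    have "emeasure (copula_law n M X) (Orth u) = emeasure M (D u)"
      unfolding copula_law_def U_def[symmetric] using VO by (subst emeasure_distr) auto
    then show "emeasure (copula_law n M X) {v \<in> {1..n} \<rightarrow>\<^sub>E UNIV. \<forall>i\<in>{1..n}. v i \<le> u i}
        = emeasure \<mu> {v \<in> {1..n} \<rightarrow>\<^sub>E UNIV. \<forall>i\<in>{1..n}. v i \<le> u i}"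
      using main[of u] by (simp add: Orth_def M.emeasure_eq_measure \<mu>.emeasure_eq_measure)
  qed (auto simp: copula_law_def sets)
qed

section \<open>Densities of MTP2 copulas\<close>

text \<open>For a joint density \<open>f\<close> this is the density of coordinate 1 on the event
  \<open>upper_box n q\<close>, not divided by the probability of that event. The normalising
  constants cancel only at the very end.\<close>

definition density_slice :: "nat \<Rightarrow> ((nat \<Rightarrow> real) \<Rightarrow> real) \<Rightarrow> (nat \<Rightarrow> real) \<Rightarrow> real \<Rightarrow> ennreal" where
  "density_slice n f q u = (\<integral>\<^sup>+x. ennreal (f (x(1 := u))) * indicator (upper_box n q) (x(1 := u))
     \<partial>Pi\<^sub>M {2..n} (\<lambda>_. lborel))"

lemma atLeastAtMost_insert_1: "1 \<le> n \<Longrightarrow> {1..n} = insert 1 {2..n::nat}"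
  by auto

lemma upper_box_sets_lborel: "upper_box n q \<in> sets (Pi\<^sub>M {1..n} (\<lambda>_. lborel))"
proof -
  have "sets (Pi\<^sub>M {1..n} (\<lambda>_. lborel :: real measure)) = sets (Pi\<^sub>M {1..n} (\<lambda>_. borel))"
    by (intro sets_PiM_cong) auto
  then show ?thesis using upper_box_sets[of n q] by simp
qed

lemma measurable_density_slice_integrand:
  assumes n: "1 \<le> n" and f: "(\<lambda>x. ennreal (f x)) \<in> borel_measurable (Pi\<^sub>M {1..n} (\<lambda>_. lborel))"
  shows "(\<lambda>x. ennreal (f x) * indicator (upper_box n q) x)
    \<in> borel_measurable (Pi\<^sub>M (insert 1 {2..n}) (\<lambda>_. lborel))"
proof -
  note [measurable] = f upper_box_sets_lborel[of n q]
  have "(\<lambda>x. ennreal (f x) * indicator (upper_box n q) x) \<in> borel_measurable (Pi\<^sub>M {1..n} (\<lambda>_. lborel))"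
    by measurable
  then show ?thesis by (simp only: atLeastAtMost_insert_1[OF n])
qed

lemma borel_measurable_density_slice:
  assumes n: "1 \<le> n" and f: "(\<lambda>x. ennreal (f x)) \<in> borel_measurable (Pi\<^sub>M {1..n} (\<lambda>_. lborel))"
  shows "density_slice n f q \<in> borel_measurable borel"
proof -
  interpret product_sigma_finite "\<lambda>_::nat. lborel :: real measure" ..
  interpret sigma_finite_measure "Pi\<^sub>M {2..n} (\<lambda>_. lborel :: real measure)"
    by (rule sigma_finite) simp
  note [measurable] = measurable_density_slice_integrand[OF assms]
  have "(\<lambda>u. \<integral>\<^sup>+x. ennreal (f (x(1 := u))) * indicator (upper_box n q) (x(1 := u))
     \<partial>Pi\<^sub>M {2..n} (\<lambda>_. lborel)) \<in> borel_measurable lborel"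
  proof (rule borel_measurable_nn_integral)
    have "(\<lambda>(u, x). x(1 := u)) \<in> measurable (lborel \<Otimes>\<^sub>M Pi\<^sub>M {2..n} (\<lambda>_. lborel)) (Pi\<^sub>M (insert 1 {2..n}) (\<lambda>_. lborel :: real measure))"
      by measurable
    from measurable_compose[OF this measurable_density_slice_integrand[OF assms]]
    show "(\<lambda>(u, x). ennreal (f (x(1 := u))) * indicator (upper_box n q) (x(1 := u)))
        \<in> borel_measurable (lborel \<Otimes>\<^sub>M Pi\<^sub>M {2..n} (\<lambda>_. lborel))"
      by (simp add: split_beta')
  qed
  then show ?thesis by (simp add: density_slice_def[abs_def])
qed

text \<open>On extensional functions \<open>rvec n\<close> applied to the coordinate maps is the
  identity, so \<open>f\<close> is a density of the measure itself.\<close>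

lemma nn_integral_distributed_coordinates:
  assumes sets: "sets \<mu> = sets (Pi\<^sub>M {1..n} (\<lambda>_. borel))"
    and dens: "distributed \<mu> (Pi\<^sub>M {1..n} (\<lambda>_. lborel)) (rvec n (\<lambda>i v. v i)) (\<lambda>x. ennreal (f x))"
    and h: "h \<in> borel_measurable (Pi\<^sub>M {1..n} (\<lambda>_. borel))"
  shows "(\<integral>\<^sup>+v. h v \<partial>\<mu>) = (\<integral>\<^sup>+x. ennreal (f x) * h x \<partial>Pi\<^sub>M {1..n} (\<lambda>_. lborel))"
proof -
  have space: "space \<mu> = {1..n} \<rightarrow>\<^sub>E UNIV" using sets_eq_imp_space_eq[OF sets] by (simp add: space_PiM)
  have s: "sets (Pi\<^sub>M {1..n} (\<lambda>_. lborel :: real measure)) = sets (Pi\<^sub>M {1..n} (\<lambda>_. borel))"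
    by (intro sets_PiM_cong) auto
  have h': "h \<in> borel_measurable (Pi\<^sub>M {1..n} (\<lambda>_. lborel))"
    using h by (simp cong: measurable_cong_sets add: s)
  have "(\<integral>\<^sup>+v. h v \<partial>\<mu>) = (\<integral>\<^sup>+v. h (rvec n (\<lambda>i v. v i) v) \<partial>\<mu>)"
    by (intro nn_integral_cong) (auto simp: space rvec_def PiE_iff extensional_restrict)
  also have "\<dots> = (\<integral>\<^sup>+x. h x \<partial>distr \<mu> (Pi\<^sub>M {1..n} (\<lambda>_. lborel)) (rvec n (\<lambda>i v. v i)))"
    using h' by (intro nn_integral_distr[symmetric] distributed_measurable[OF dens]) simp
  also have "\<dots> = (\<integral>\<^sup>+x. ennreal (f x) * h x \<partial>Pi\<^sub>M {1..n} (\<lambda>_. lborel))"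
    unfolding distributed_distr_eq_density[OF dens]
    by (intro nn_integral_density distributed_borel_measurable[OF dens] h')
  finally show ?thesis .
qed

text \<open>Tonelli with coordinate 1 as the outer variable.\<close>

lemma nn_integral_density_slice:
  assumes n: "1 \<le> n" and sets: "sets \<mu> = sets (Pi\<^sub>M {1..n} (\<lambda>_. borel))"
    and dens: "distributed \<mu> (Pi\<^sub>M {1..n} (\<lambda>_. lborel)) (rvec n (\<lambda>i v. v i)) (\<lambda>x. ennreal (f x))"
    and h[measurable]: "h \<in> borel_measurable borel"
  shows "(\<integral>\<^sup>+v. h (v 1) * indicator (upper_box n q) v \<partial>\<mu>) = (\<integral>\<^sup>+u. h u * density_slice n f q u \<partial>lborel)"
proof -
  interpret product_sigma_finite "\<lambda>_::nat. lborel :: real measure" ..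
  have f: "(\<lambda>x. ennreal (f x)) \<in> borel_measurable (Pi\<^sub>M {1..n} (\<lambda>_. lborel))"
    by (rule distributed_borel_measurable[OF dens])
  have one: "1 \<in> {1..n}" using n by auto
  note int = measurable_density_slice_integrand[OF n f, of q]
  note [measurable] = upper_box_sets[of n q] int
  have [measurable]: "(\<lambda>v. v 1) \<in> borel_measurable (Pi\<^sub>M {1..n} (\<lambda>_. borel :: real measure))"
    using one by measurable
  have [measurable]: "(\<lambda>v. v 1) \<in> borel_measurable (Pi\<^sub>M (insert 1 {2..n}) (\<lambda>_. lborel :: real measure))"
    using measurable_component_singleton[of 1 "insert 1 {2..n}" "\<lambda>_. lborel :: real measure"] by simp
  have "(\<integral>\<^sup>+v. h (v 1) * indicator (upper_box n q) v \<partial>\<mu>)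
      = (\<integral>\<^sup>+x. ennreal (f x) * (h (x 1) * indicator (upper_box n q) x) \<partial>Pi\<^sub>M {1..n} (\<lambda>_. lborel))"
    by (rule nn_integral_distributed_coordinates[OF sets dens]) measurable
  also have "\<dots> = (\<integral>\<^sup>+x. h (x 1) * (ennreal (f x) * indicator (upper_box n q) x)
      \<partial>Pi\<^sub>M (insert 1 {2..n}) (\<lambda>_. lborel))"
    unfolding atLeastAtMost_insert_1[OF n] by (simp add: mult_ac)
  also have "\<dots> = (\<integral>\<^sup>+u. (\<integral>\<^sup>+x. h u * (ennreal (f (x(1 := u))) * indicator (upper_box n q) (x(1 := u)))
      \<partial>Pi\<^sub>M {2..n} (\<lambda>_. lborel)) \<partial>lborel)"
    by (subst product_nn_integral_insert_rev) auto
  also have "\<dots> = (\<integral>\<^sup>+u. h u * density_slice n f q u \<partial>lborel)"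
    unfolding density_slice_def
  proof (intro nn_integral_cong nn_integral_cmult)
    fix u :: real
    have "(\<lambda>x. x(1 := u)) \<in> measurable (Pi\<^sub>M {2..n} (\<lambda>_. lborel)) (Pi\<^sub>M (insert 1 {2..n}) (\<lambda>_. lborel :: real measure))"
      by measurable
    from measurable_compose[OF this int]
    show "(\<lambda>x. ennreal (f (x(1 := u))) * indicator (upper_box n q) (x(1 := u)))
        \<in> borel_measurable (Pi\<^sub>M {2..n} (\<lambda>_. lborel))" .
  qed
  finally show ?thesis .
qed

lemma density_slice_mono:
  assumes "\<And>j. j \<in> {2..n} \<Longrightarrow> q' j \<le> q j"
  shows "density_slice n f q u \<le> density_slice n f q' u"
proof -
  have "upper_box n q \<subseteq> upper_box n q'"
  proof
    fix v assume v: "v \<in> upper_box n q"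
    have "q' j < v j" if "j \<in> {2..n}" for j
      using assms[OF that] v that by (force simp: upper_box_def)
    then show "v \<in> upper_box n q'" using v by (simp add: upper_box_def)
  qed
  then show ?thesis
    unfolding density_slice_def
    by (intro nn_integral_mono mult_left_mono) (auto split: split_indicator)
qed

text \<open>The four functions theorem in the coordinates from 2 on, for a point above
  \<open>q'\<close> at height \<open>u'\<close> and a point above \<open>q\<close> at height
  \<open>u\<close>. Their maximum lies above \<open>q\<close> at height \<open>u'\<close>; their
  minimum lies above \<open>q'\<close> at height \<open>u\<close>, since
  \<open>q' \<le> q\<close>.\<close>

lemma density_slice_TP2:
  assumes n: "1 \<le> n"
    and f: "(\<lambda>x. ennreal (f x)) \<in> borel_measurable (Pi\<^sub>M {1..n} (\<lambda>_. lborel))"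
    and nonneg: "\<And>x. x \<in> {1..n} \<rightarrow>\<^sub>E UNIV \<Longrightarrow> 0 \<le> f x"
    and tp: "\<And>x y. x \<in> {1..n} \<rightarrow>\<^sub>E UNIV \<Longrightarrow> y \<in> {1..n} \<rightarrow>\<^sub>E UNIV \<Longrightarrow>
      f x * f y \<le> f (\<lambda>i\<in>{1..n}. min (x i) (y i)) * f (\<lambda>i\<in>{1..n}. max (x i) (y i))"
    and q: "\<And>j. j \<in> {2..n} \<Longrightarrow> q' j \<le> q j" and u: "u \<le> u'"
  shows "density_slice n f q u * density_slice n f q' u' \<le> density_slice n f q u' * density_slice n f q' u"
proof -
  let ?c = "\<lambda>q u x. ennreal (f (x(1 := u))) * indicator (upper_box n q) (x(1 := u))"
  have meas: "?c q u \<in> borel_measurable (Pi\<^sub>M {2..n} (\<lambda>_. lborel))" for q u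
  proof -
    have "(\<lambda>x. x(1 := u)) \<in> measurable (Pi\<^sub>M {2..n} (\<lambda>_. lborel)) (Pi\<^sub>M (insert 1 {2..n}) (\<lambda>_. lborel :: real measure))"
      by measurable
    from measurable_compose[OF this measurable_density_slice_integrand[OF n f]] show ?thesis .
  qed
  have "density_slice n f q' u' * density_slice n f q u \<le> density_slice n f q u' * density_slice n f q' u"
    unfolding density_slice_def
  proof (rule four_functions_PiM)
    fix x y :: "nat \<Rightarrow> real" assume x: "x \<in> {2..n} \<rightarrow>\<^sub>E UNIV" and y: "y \<in> {2..n} \<rightarrow>\<^sub>E UNIV"
    let ?x = "x(1 := u')" and ?y = "y(1 := u)"
    have in1: "?x \<in> {1..n} \<rightarrow>\<^sub>E UNIV" "?y \<in> {1..n} \<rightarrow>\<^sub>E UNIV"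
      using x y n by (auto simp: PiE_iff extensional_def)
    have max: "(\<lambda>i\<in>{1..n}. max (?x i) (?y i)) = (\<lambda>i\<in>{2..n}. max (x i) (y i))(1 := u')"
      and min: "(\<lambda>i\<in>{1..n}. min (?x i) (?y i)) = (\<lambda>i\<in>{2..n}. min (x i) (y i))(1 := u)"
      using u n by (auto simp: fun_eq_iff max_def min_def)
    have in2: "(\<lambda>i\<in>{2..n}. max (x i) (y i))(1 := u') \<in> {1..n} \<rightarrow>\<^sub>E UNIV"
      "(\<lambda>i\<in>{2..n}. min (x i) (y i))(1 := u) \<in> {1..n} \<rightarrow>\<^sub>E UNIV"
      using n by (auto simp: PiE_iff extensional_def)
    have "ennreal (f ?x) * ennreal (f ?y)
        \<le> ennreal (f ((\<lambda>i\<in>{2..n}. max (x i) (y i))(1 := u'))) * ennreal (f ((\<lambda>i\<in>{2..n}. min (x i) (y i))(1 := u)))"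
      using tp[OF in1] nonneg[OF in1(1)] nonneg[OF in1(2)] nonneg[OF in2(1)] nonneg[OF in2(2)]
      unfolding max min by (simp add: ennreal_mult[symmetric] mult.commute ennreal_leI)
    moreover have "?x \<in> upper_box n q' \<Longrightarrow> ?y \<in> upper_box n q \<Longrightarrow>
        (\<lambda>i\<in>{2..n}. max (x i) (y i))(1 := u') \<in> upper_box n q \<and>
        (\<lambda>i\<in>{2..n}. min (x i) (y i))(1 := u) \<in> upper_box n q'"
      using in2 q by (fastforce simp: upper_box_def less_max_iff_disj intro: le_less_trans)
    ultimately show "?c q' u' x * ?c q u y
        \<le> ?c q u' (\<lambda>i\<in>{2..n}. max (x i) (y i)) * ?c q' u (\<lambda>i\<in>{2..n}. min (x i) (y i))"
      by (auto split: split_indicator)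
  qed (auto intro!: meas)
  then show ?thesis by (simp add: mult.commute)
qed

text \<open>Cut both slices at the point \<open>x = Q q\<close>. The slice for \<open>q\<close>
  below the cut and that for \<open>q'\<close> above it give a nonzero product only for arguments in
  the order that \<open>tp\<close> compares, so the one-dimensional four functions theorem yields
  \<open>lo q * hi q' \<le> hi q * lo q'\<close>. Hence the conditional distribution function at
  \<open>x\<close> is at least as large for \<open>q'\<close>, and its quantile is at most
  \<open>x\<close>.\<close>

lemma MTP2_copula_VaR_mono:
  fixes n f \<mu> t
  defines "Q \<equiv> \<lambda>q. VaR (uniform_measure \<mu> (upper_box n q)) (\<lambda>v. v 1) t"
  assumes n: "1 \<le> n" and "prob_space \<mu>" and sets: "sets \<mu> = sets (Pi\<^sub>M {1..n} (\<lambda>_. borel))"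
    and dens: "distributed \<mu> (Pi\<^sub>M {1..n} (\<lambda>_. lborel)) (rvec n (\<lambda>i v. v i)) (\<lambda>x. ennreal (f x))"
    and tp: "\<And>u u'. u \<le> u' \<Longrightarrow>
      density_slice n f q u * density_slice n f q' u' \<le> density_slice n f q u' * density_slice n f q' u"
    and pos: "0 < emeasure \<mu> (upper_box n q)" "0 < emeasure \<mu> (upper_box n q')"
    and t: "0 < t" "t < 1"
  shows "Q q' \<le> Q q"
proof -
  interpret prob_space \<mu> by fact
  have one: "1 \<in> {1..n}" using n by auto
  have box[measurable]: "upper_box n r \<in> sets \<mu>" for r using upper_box_sets by (simp add: sets)
  have V[measurable]: "(\<lambda>v. v 1) \<in> borel_measurable \<mu>"
    using measurable_component_singleton[OF one, of "\<lambda>_. borel :: real measure"]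
    by (simp add: measurable_cong_sets[OF sets refl])
  have f: "(\<lambda>x. ennreal (f x)) \<in> borel_measurable (Pi\<^sub>M {1..n} (\<lambda>_. lborel))"
    by (rule distributed_borel_measurable[OF dens])
  note [measurable] = borel_measurable_density_slice[OF n f]
  have prob: "prob_space (uniform_measure \<mu> (upper_box n r))" if "0 < emeasure \<mu> (upper_box n r)" for r
    using that by (intro prob_space_uniform_measure) auto
  have Vr: "(\<lambda>v. v 1) \<in> borel_measurable (uniform_measure \<mu> (upper_box n r))" for r
    using V by (simp cong: measurable_cong_sets)
  define x where "x = Q q"
  define lo hi where "lo r = measure \<mu> (upper_box n r \<inter> {v \<in> space \<mu>. v 1 \<le> x})"
    and "hi r = measure \<mu> (upper_box n r \<inter> {v \<in> space \<mu>. x < v 1})" for r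
  have lo: "ennreal (lo r) = (\<integral>\<^sup>+u. density_slice n f r u * indicator {..x} u \<partial>lborel)" for r
  proof -
    have "(\<integral>\<^sup>+v. indicator {..x} (v 1) * indicator (upper_box n r) v \<partial>\<mu>)
        = (\<integral>\<^sup>+v. indicator (upper_box n r \<inter> {v \<in> space \<mu>. v 1 \<le> x}) v \<partial>\<mu>)"
      by (intro nn_integral_cong) (auto split: split_indicator)
    also have "\<dots> = ennreal (lo r)" by (simp add: lo_def emeasure_eq_measure)
    finally have "ennreal (lo r) = (\<integral>\<^sup>+v. indicator {..x} (v 1) * indicator (upper_box n r) v \<partial>\<mu>)" ..
    then show ?thesis
      by (subst (asm) nn_integral_density_slice[OF n sets dens]) (auto simp: mult.commute)
  qed
  have hi: "ennreal (hi r) = (\<integral>\<^sup>+u. density_slice n f r u * indicator {x<..} u \<partial>lborel)" for r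
  proof -
    have "(\<integral>\<^sup>+v. indicator {x<..} (v 1) * indicator (upper_box n r) v \<partial>\<mu>)
        = (\<integral>\<^sup>+v. indicator (upper_box n r \<inter> {v \<in> space \<mu>. x < v 1}) v \<partial>\<mu>)"
      by (intro nn_integral_cong) (auto split: split_indicator)
    also have "\<dots> = ennreal (hi r)" by (simp add: hi_def emeasure_eq_measure)
    finally have "ennreal (hi r) = (\<integral>\<^sup>+v. indicator {x<..} (v 1) * indicator (upper_box n r) v \<partial>\<mu>)" ..
    then show ?thesis
      by (subst (asm) nn_integral_density_slice[OF n sets dens]) (auto simp: mult.commute)
  qed
  have nn: "0 \<le> lo r" "0 \<le> hi r" for r by (auto simp: lo_def hi_def)
  have "ennreal (lo q) * ennreal (hi q') \<le> ennreal (hi q) * ennreal (lo q')"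
    unfolding lo hi
    by (rule four_functions_real) (auto split: split_indicator simp: max_def min_def intro: tp)
  then have cross: "lo q * hi q' \<le> hi q * lo q'" using nn by (simp add: ennreal_mult[symmetric])
  have sum: "measure \<mu> (upper_box n r) = lo r + hi r" for r
    unfolding lo_def hi_def
    by (subst finite_measure_Union[symmetric])
      (auto intro!: arg_cong[where f = "measure \<mu>"] dest: subsetD[OF sets.sets_into_space[OF box]])
  have pos': "0 < lo q + hi q" "0 < lo q' + hi q'"
    using pos by (auto simp: sum[symmetric] emeasure_eq_measure)
  have dist: "dist_fun (uniform_measure \<mu> (upper_box n r)) (\<lambda>v. v 1) x = lo r / (lo r + hi r)"
    if "0 < emeasure \<mu> (upper_box n r)" for r
  proof -
    have "dist_fun (uniform_measure \<mu> (upper_box n r)) (\<lambda>v. v 1) x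
        = measure (uniform_measure \<mu> (upper_box n r)) {v \<in> space \<mu>. v 1 \<le> x}"
      by (subst dist_fun_eq[OF Vr]) simp
    also have "\<dots> = measure \<mu> (upper_box n r \<inter> {v \<in> space \<mu>. v 1 \<le> x}) / measure \<mu> (upper_box n r)"
      using that by (intro measure_uniform_measure) auto
    finally show ?thesis by (simp only: sum lo_def hi_def)
  qed
  have "t \<le> lo q / (lo q + hi q)"
    using VaR_le_iff[OF prob[OF pos(1)] Vr t, of x] dist[OF pos(1)] by (simp add: x_def Q_def)
  also have "\<dots> \<le> lo q' / (lo q' + hi q')"
    using cross pos' by (simp add: divide_le_eq pos_le_divide_eq field_simps)
  finally show ?thesis
    using VaR_le_iff[OF prob[OF pos(2)] Vr t, of x] dist[OF pos(2)] by (simp add: x_def Q_def)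
qed

text \<open>Distribution functions are nonnegative, so levels -1 impose nothing and only the uniform
  law of the first transformed component remains. It identifies the slice without stress.\<close>

lemma nn_integral_copula_law_uniform:
  assumes "prob_space M" and n: "1 \<le> n" and meas: "\<And>i. i \<in> {1..n} \<Longrightarrow> X i \<in> borel_measurable M"
    and cont: "\<And>i. i \<in> {1..n} \<Longrightarrow> continuous_on UNIV (dist_fun M (X i))"
    and [measurable]: "h \<in> borel_measurable borel"
  shows "(\<integral>\<^sup>+v. h (v 1) * indicator (upper_box n (\<lambda>_. -1)) v \<partial>copula_law n M X)
    = (\<integral>\<^sup>+u. h u * indicator {0<..<1} u \<partial>lborel)"
proof -
  have one: "1 \<in> {1..n}" using n by auto
  note V = measurable_copula_map[OF assms(1) meas]
  note [measurable] = upper_box_sets[of n "\<lambda>_. -1"]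
  have [measurable]: "(\<lambda>v. v 1) \<in> borel_measurable (Pi\<^sub>M {1..n} (\<lambda>_. borel :: real measure))"
    using one by measurable
  have box: "rvec n (\<lambda>i \<omega>. dist_fun M (X i) (X i \<omega>)) \<omega> \<in> upper_box n (\<lambda>_. -1)" for \<omega>
  proof -
    have "-1 < dist_fun M (X j) (X j \<omega>)" if "j \<in> {2..n}" for j
    proof -
      have "0 \<le> dist_fun M (X j) (X j \<omega>)"
        using that by (subst dist_fun_eq) (auto intro: meas)
      then show ?thesis by simp
    qed
    then show ?thesis by (auto simp: upper_box_def rvec_def)
  qed
  have "(\<integral>\<^sup>+v. h (v 1) * indicator (upper_box n (\<lambda>_. -1)) v \<partial>copula_law n M X)
      = (\<integral>\<^sup>+\<omega>. h (rvec n (\<lambda>i \<omega>. dist_fun M (X i) (X i \<omega>)) \<omega> 1)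
          * indicator (upper_box n (\<lambda>_. -1)) (rvec n (\<lambda>i \<omega>. dist_fun M (X i) (X i \<omega>)) \<omega>) \<partial>M)"
    unfolding copula_law_def by (rule nn_integral_distr[OF V]) measurable
  also have "\<dots> = (\<integral>\<^sup>+\<omega>. h (dist_fun M (X 1) (X 1 \<omega>)) \<partial>M)"
    using n by (intro nn_integral_cong) (simp only: box indicator_simps mult_1_right, simp add: rvec_def)
  also have "\<dots> = (\<integral>\<^sup>+u. h u * indicator {0<..<1} u \<partial>lborel)"
    by (rule nn_integral_dist_fun[OF assms(1) meas[OF one] _ cont[OF one]]) measurable
  finally show ?thesis .
qed

section \<open>Comparison of the two median-type contributions\<close>

theorem theorem3p12:
  fixes n :: nat
    and M :: "'a measure" and N :: "'b measure"
    and X :: "nat \<Rightarrow> 'a \<Rightarrow> real" and Y :: "nat \<Rightarrow> 'b \<Rightarrow> real"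
    and f g :: "(nat \<Rightarrow> real) \<Rightarrow> real"
    and C :: "(nat \<Rightarrow> real) \<Rightarrow> real"
    and p :: "nat \<Rightarrow> real"
  assumes "n \<ge> 2"
    and "prob_space M" and "prob_space N"
    and "distributed M (Pi\<^sub>M {1..n} (\<lambda>_. lborel)) (rvec n X) (\<lambda>x. ennreal (f x))"
    and "distributed N (Pi\<^sub>M {1..n} (\<lambda>_. lborel)) (rvec n Y) (\<lambda>x. ennreal (g x))"
    and "\<forall>i\<in>{1..n}. AE \<omega> in M. 0 \<le> X i \<omega>"
    and "\<forall>i\<in>{1..n}. AE \<omega> in N. 0 \<le> Y i \<omega>"
    and "\<forall>i\<in>{1..n}. continuous_on UNIV (dist_fun M (X i))"
    and "\<forall>i\<in>{1..n}. continuous_on UNIV (dist_fun N (Y i))"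
    and "\<forall>i\<in>{1..n}. integrable M (X i)"
    and "\<forall>i\<in>{1..n}. integrable N (Y i)"
    and "is_copula_of n M X C" and "is_copula_of n N Y C"
    and "MTP2_copula n C"
    and "p 1 \<in> {0<..<1}" and "\<forall>j\<in>{2..n}. p j \<in> {1/2<..<1}"
    and "\<forall>q \<in> {p, median_levels p}. measure M (stress_event n M X q) > 0"
    and "\<forall>q \<in> {p, median_levels p}. measure N (stress_event n N Y q) > 0"
    and "MCoES n M X (median_levels p) \<noteq> 0" and "MCoES n N Y (median_levels p) \<noteq> 0"
    and "ps_le M (X 1) N (Y 1)"
  shows "Delta_R_med_MCoES n M X p \<le> Delta_R_med_MCoES n N Y p"
proof -
  have n: "1 \<le> n" and one: "1 \<in> {1..n}" using assms(1) by auto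
  have intX: "integrable M (X i)" and contX: "continuous_on UNIV (dist_fun M (X i))"
    and intY: "integrable N (Y i)" and contY: "continuous_on UNIV (dist_fun N (Y i))"
    if "i \<in> {1..n}" for i
    using that assms(8-11) by auto
  have measX: "X i \<in> borel_measurable M" and measY: "Y i \<in> borel_measurable N" if "i \<in> {1..n}" for i
    using intX[OF that] intY[OF that] by auto
  have nnX: "AE \<omega> in M. 0 \<le> X 1 \<omega>" and nnY: "AE \<omega> in N. 0 \<le> Y 1 \<omega>"
    using assms(6,7) one by auto
  obtain \<mu> c where "prob_space \<mu>" and sets: "sets \<mu> = sets (Pi\<^sub>M {1..n} (\<lambda>_. borel))"
    and \<mu>C': "\<forall>u \<in> {1..n} \<rightarrow>\<^sub>E {0..1}. measure \<mu> {v \<in> space \<mu>. \<forall>i\<in>{1..n}. v i \<le> u i} = C u"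
    and dens: "distributed \<mu> (Pi\<^sub>M {1..n} (\<lambda>_. lborel)) (rvec n (\<lambda>i v. v i)) (\<lambda>x. ennreal (c x))"
    and nonneg': "\<forall>x \<in> {1..n} \<rightarrow>\<^sub>E UNIV. 0 \<le> c x"
    and MTP': "\<forall>x \<in> {1..n} \<rightarrow>\<^sub>E UNIV. \<forall>y \<in> {1..n} \<rightarrow>\<^sub>E UNIV.
      c x * c y \<le> c (\<lambda>i\<in>{1..n}. min (x i) (y i)) * c (\<lambda>i\<in>{1..n}. max (x i) (y i))"
    using assms(14) unfolding MTP2_copula_def MTP2_def by (elim exE conjE) (rule that)
  note \<mu>C = bspec[OF \<mu>C'] and nonneg = bspec[OF nonneg'] and MTP = bspec[OF bspec[OF MTP']]
  interpret \<mu>: prob_space \<mu> by fact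
  have lawX: "copula_law n M X = \<mu>"
    by (rule copula_law_eq[OF assms(2) measX contX assms(12) \<open>prob_space \<mu>\<close> sets \<mu>C])
  have lawY: "copula_law n N Y = \<mu>"
    by (rule copula_law_eq[OF assms(3) measY contY assms(13) \<open>prob_space \<mu>\<close> sets \<mu>C])
  have c_meas: "(\<lambda>x. ennreal (c x)) \<in> borel_measurable (Pi\<^sub>M {1..n} (\<lambda>_. lborel))"
    by (rule distributed_borel_measurable[OF dens])
  define w where "w = density_slice n c"
  note w_meas [measurable] = borel_measurable_density_slice[OF n c_meas, folded w_def]
  have w_int: "(\<integral>\<^sup>+v. h (v 1) * indicator (upper_box n q) v \<partial>\<mu>) = (\<integral>\<^sup>+u. h u * w q u \<partial>lborel)"
    if "h \<in> borel_measurable borel" for h q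
    unfolding w_def by (rule nn_integral_density_slice[OF n sets dens that])
  have TP2: "w q u * w q' u' \<le> w q u' * w q' u" if "\<And>j. j \<in> {2..n} \<Longrightarrow> q' j \<le> q j" "u \<le> u'" for q q' u u'
    unfolding w_def by (rule density_slice_TP2[OF n c_meas nonneg MTP that])
  \<comment> \<open>The slice without stress is a density of the uniform law, hence 1 almost
    everywhere on (0,1). \<open>E\<close> keeps the points where the chosen version has exactly this
    value, so that it can be cancelled pointwise.\<close>
  define E where "E = {u \<in> {0<..<1}. w (\<lambda>_. -1) u = 1}"
  have E_sets [measurable]: "E \<in> sets borel" unfolding E_def by measurable
  have E_AE: "AE u in lborel. u \<in> {0<..<1} \<longrightarrow> u \<in> E"
  proof -
    have "density lborel (w (\<lambda>_. -1)) = density lborel (indicator {0<..<1})"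
    proof (rule measure_eqI)
      fix A assume "A \<in> sets (density lborel (w (\<lambda>_. -1)))"
      then have [measurable]: "A \<in> sets borel" by simp
      have "(\<integral>\<^sup>+u. indicator A u * w (\<lambda>_. -1) u \<partial>lborel) = (\<integral>\<^sup>+u. indicator A u * indicator {0<..<1} u \<partial>lborel)"
        using nn_integral_copula_law_uniform[where X = X and h = "indicator A", OF assms(2) n measX contX]
        by (subst w_int[symmetric]) (auto simp: lawX)
      then show "emeasure (density lborel (w (\<lambda>_. -1))) A = emeasure (density lborel (indicator {0<..<1})) A"
        by (simp add: emeasure_density mult.commute)
    qed simp
    then have "AE u in lborel. w (\<lambda>_. -1) u = indicator {0<..<1} u"
      by (intro sigma_finite_measure.density_unique[OF lborel.sigma_finite_measure_axioms]) auto
    then show ?thesis by eventually_elim (auto simp: E_def)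
  qed
  have E_sub: "E \<subseteq> {0<..<1}" by (auto simp: E_def)

  define h where "h = median_levels p"
  have h1: "h 1 = p 1" by (simp add: h_def median_levels_def)
  have hj: "h j = 1 / 2" if "j \<in> {2..n}" for j
    using that by (auto simp: h_def median_levels_def)
  have p1: "0 < p 1" "p 1 < 1" using assms(15) by auto
  have pj: "1 / 2 < p j" "p j < 1" if "j \<in> {2..n}" for j using assms(16) that by auto
  have p01: "0 < p i \<and> p i < 1" and h01: "0 < h i \<and> h i < 1" if "i \<in> {1..n}" for i
  proof -
    have "i = 1 \<or> i \<in> {2..n}" using that by auto
    then show "0 < p i \<and> p i < 1" "0 < h i \<and> h i < 1"
      using p1 pj[of i] h1 hj[of i] by auto
  qed
  have h_le_p: "h j \<le> p j" if "j \<in> {2..n}" for j using pj[OF that] hj[OF that] by simp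

  \<comment> \<open>Both shortfalls as integrals against the same weights\<close>
  define Q where "Q q = VaR (uniform_measure \<mu> (upper_box n q)) (\<lambda>v. v 1) (p 1)" for q
  define K where "K q = measure \<mu> (upper_box n q)" for q
  define w' where "w' q u = w q u * indicator {Q q<..} u" for q u
  define a where "a u = (if u \<in> {0<..<1} then VaR M (X 1) u else 0)" for u
  define b where "b u = (if u \<in> {0<..<1} then VaR N (Y 1) u else 0)" for u
  have a_meas [measurable]: "a \<in> borel_measurable borel" and b_meas [measurable]: "b \<in> borel_measurable borel"
    unfolding a_def b_def
    using borel_measurable_VaR[OF assms(2) measX[OF one]] borel_measurable_VaR[OF assms(3) measY[OF one]]
    by auto
  have [measurable]: "w' q \<in> borel_measurable borel" for q unfolding w'_def by measurable
  define I where "I r q = (\<integral>\<^sup>+u. ennreal (r u) * w' q u * indicator E u \<partial>lborel)" for r :: "real \<Rightarrow> real" and q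

  \<comment> \<open>Outside (0,1) the integrand is 0, and inside, \<open>E\<close> omits only a null
    set.\<close>
  have I_eq: "(\<integral>\<^sup>+v. ennreal (r (v 1)) * indicator {Q q<..} (v 1) * indicator (upper_box n q) v \<partial>\<mu>) = I r q"
    if [measurable]: "r \<in> borel_measurable borel" and r: "\<And>u. u \<notin> {0<..<1} \<Longrightarrow> r u = 0" for r q
  proof -
    have "(\<integral>\<^sup>+v. ennreal (r (v 1)) * indicator {Q q<..} (v 1) * indicator (upper_box n q) v \<partial>\<mu>)
        = (\<integral>\<^sup>+u. ennreal (r u) * indicator {Q q<..} u * w q u \<partial>lborel)"
      by (rule w_int) measurable
    also have "\<dots> = I r q"
      unfolding I_def
    proof (rule nn_integral_cong_AE)
      show "AE u in lborel. ennreal (r u) * indicator {Q q<..} u * w q u = ennreal (r u) * w' q u * indicator E u"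
        using E_AE
      proof eventually_elim
        case (elim u)
        then show ?case
          by (cases "u \<in> {0<..<1}") (simp_all add: w'_def r mult_ac del: greaterThanLessThan_iff)
      qed
    qed
    finally show ?thesis .
  qed
  have I_a: "(\<integral>\<^sup>+v. ennreal (a (v 1)) * indicator {Q q<..} (v 1) * indicator (upper_box n q) v \<partial>\<mu>) = I a q"
    and I_b: "(\<integral>\<^sup>+v. ennreal (b (v 1)) * indicator {Q q<..} (v 1) * indicator (upper_box n q) v \<partial>\<mu>) = I b q" for q
    by (rule I_eq[OF a_meas] I_eq[OF b_meas]; simp add: a_def b_def del: greaterThanLessThan_iff)+
  have posX: "0 < measure M (stress_event n M X q)" and posY: "0 < measure N (stress_event n N Y q)"
    if "q \<in> {p, h}" for q using assms(17,18) that by (auto simp: h_def)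
  have lev: "0 < q i \<and> q i < 1" if "q \<in> {p, h}" "i \<in> {1..n}" for q i
    using that p01 h01 by auto
  have lev1: "q 1 = p 1" if "q \<in> {p, h}" for q using that h1 by auto
  have ESX: "MCoES n M X q = enn2real (I a q / emeasure \<mu> (upper_box n q)) / (1 - p 1)"
    and ESY: "MCoES n N Y q = enn2real (I b q / emeasure \<mu> (upper_box n q)) / (1 - p 1)"
    and KX: "emeasure \<mu> (upper_box n q) = ennreal (measure M (stress_event n M X q))"
    if q: "q \<in> {p, h}" for q
  proof -
    note MX = MCoES_eq_copula_integral[OF assms(2) n measX contX intX[OF one] nnX lev[OF q] posX[OF q]]
    note MY = MCoES_eq_copula_integral[OF assms(3) n measY contY intY[OF one] nnY lev[OF q] posY[OF q]]
    show "emeasure \<mu> (upper_box n q) = ennreal (measure M (stress_event n M X q))"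
      using MX(2) by (simp only: lawX)
    show "MCoES n M X q = enn2real (I a q / emeasure \<mu> (upper_box n q)) / (1 - p 1)"
      using MX(1) by (simp only: lawX a_def[symmetric] Q_def[symmetric] lev1[OF q] I_a)
    show "MCoES n N Y q = enn2real (I b q / emeasure \<mu> (upper_box n q)) / (1 - p 1)"
      using MY(1) by (simp only: lawY b_def[symmetric] Q_def[symmetric] lev1[OF q] I_b)
  qed
  have K: "emeasure \<mu> (upper_box n q) = ennreal (K q)" "0 < K q" if "q \<in> {p, h}" for q
    using KX[OF that] posX[OF that] by (auto simp: K_def \<mu>.emeasure_eq_measure)

  \<comment> \<open>Quantile functions and the proportional shortfall order\<close>
  have a_pos: "0 < a u" and b_pos: "0 < b u" if "0 < u" "u < 1" for u
    using that VaR_pos[OF assms(2) measX contX nnX, OF one one] VaR_pos[OF assms(3) measY contY nnY, OF one one]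
    by (auto simp: a_def b_def)
  have a_mono: "a x \<le> a y" and b_mono: "b x \<le> b y" if "0 < x" "x \<le> y" "y < 1" for x y
    using that mono_VaR[OF assms(2) measX[OF one]] mono_VaR[OF assms(3) measY[OF one]]
    by (auto simp: a_def b_def)
  have a_fin: "(\<integral>\<^sup>+x. ennreal (a x) * indicator {0<..<1} x \<partial>lborel) < \<top>"
  proof -
    have "(\<integral>\<^sup>+x. ennreal (a x) * indicator {0<..<1} x \<partial>lborel) = (\<integral>\<^sup>+\<omega>. ennreal (X 1 \<omega>) \<partial>M)"
      by (subst nn_integral_VaR[OF assms(2) measX[OF one], symmetric])
        (auto simp: a_def intro!: nn_integral_cong split: split_indicator)
    then show ?thesis using nn_integral_eq_integral[OF intX[OF one] nnX] by simp
  qed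
  have b_fin: "(\<integral>\<^sup>+x. ennreal (b x) * indicator {0<..<1} x \<partial>lborel) < \<top>"
  proof -
    have "(\<integral>\<^sup>+x. ennreal (b x) * indicator {0<..<1} x \<partial>lborel) = (\<integral>\<^sup>+\<omega>. ennreal (Y 1 \<omega>) \<partial>N)"
      by (subst nn_integral_VaR[OF assms(3) measY[OF one], symmetric])
        (auto simp: b_def intro!: nn_integral_cong split: split_indicator)
    then show ?thesis using nn_integral_eq_integral[OF intY[OF one] nnY] by simp
  qed
  \<comment> \<open>Each tail is its quantile times \<open>EPS + (1 - s)\<close>; with the common
    factor \<open>a s * b s\<close> removed, what remains is the order at level s.\<close>
  have bA: "ennreal (b s) * (\<integral>\<^sup>+x. ennreal (a x) * indicator {s<..<1} x \<partial>lborel)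
      \<le> ennreal (a s) * (\<integral>\<^sup>+x. ennreal (b x) * indicator {s<..<1} x \<partial>lborel)" if s: "0 < s" "s < 1" for s
  proof -
    have "(\<integral>\<^sup>+x. ennreal (a x) * indicator {s<..<1} x \<partial>lborel)
        = (\<integral>\<^sup>+x. ennreal (VaR M (X 1) x) * indicator {s<..<1} x \<partial>lborel)"
      using s by (intro nn_integral_cong) (auto simp: a_def split: split_indicator)
    also have "\<dots> = ennreal (a s * (EPS M (X 1) s + (1 - s)))"
      using upper_VaR_integral_eq_EPS(1)[OF assms(2) intX[OF one] contX[OF one] nnX s] s by (simp add: a_def)
    finally have A: "(\<integral>\<^sup>+x. ennreal (a x) * indicator {s<..<1} x \<partial>lborel) = ennreal (a s * (EPS M (X 1) s + (1 - s)))" .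
    have "(\<integral>\<^sup>+x. ennreal (b x) * indicator {s<..<1} x \<partial>lborel)
        = (\<integral>\<^sup>+x. ennreal (VaR N (Y 1) x) * indicator {s<..<1} x \<partial>lborel)"
      using s by (intro nn_integral_cong) (auto simp: b_def split: split_indicator)
    also have "\<dots> = ennreal (b s * (EPS N (Y 1) s + (1 - s)))"
      using upper_VaR_integral_eq_EPS(1)[OF assms(3) intY[OF one] contY[OF one] nnY s] s by (simp add: b_def)
    finally have B: "(\<integral>\<^sup>+x. ennreal (b x) * indicator {s<..<1} x \<partial>lborel) = ennreal (b s * (EPS N (Y 1) s + (1 - s)))" .
    have "s \<in> pos_levels M (X 1) \<inter> pos_levels N (Y 1)"
      using s a_pos[OF s] b_pos[OF s] by (auto simp: pos_levels_def a_def b_def)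
    then have "EPS M (X 1) s \<le> EPS N (Y 1) s" using assms(21) by (auto simp: ps_le_def)
    then have "b s * (a s * (EPS M (X 1) s + (1 - s))) \<le> a s * (b s * (EPS N (Y 1) s + (1 - s)))"
      using a_pos[OF s] b_pos[OF s] by (simp add: mult.left_commute)
    then show ?thesis
      unfolding A B using a_pos[OF s] b_pos[OF s] by (simp add: ennreal_mult'[symmetric] ennreal_leI)
  qed

  \<comment> \<open>Monotonicity of the weights and of their ratio\<close>
  have w_le1: "w q u \<le> 1" if "u \<in> E" and q: "\<And>j. j \<in> {2..n} \<Longrightarrow> 0 < q j" for q u
  proof -
    have "w q u \<le> w (\<lambda>_. -1) u"
      unfolding w_def
    proof (rule density_slice_mono)
      show "-1 \<le> q j" if "j \<in> {2..n}" for j using q[OF that] by simp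
    qed
    then show ?thesis using that by (simp add: E_def)
  qed
  have h_pos: "0 < h j" if "j \<in> {2..n}" for j using hj[OF that] by simp
  have w_mono: "w h u \<le> w h u'" if "u \<in> E" "u' \<in> E" "u \<le> u'" for u u'
  proof -
    \<comment> \<open>Total positivity against the slice without stress, whose factors are 1 on
      \<open>E\<close>.\<close>
    have "w h u * w (\<lambda>_. -1) u' \<le> w h u' * w (\<lambda>_. -1) u"
    proof (rule TP2)
      show "-1 \<le> h j" if "j \<in> {2..n}" for j using h_pos[OF that] by simp
    qed fact
    then show ?thesis using that by (simp add: E_def)
  qed
  have Q_le: "Q h \<le> Q p"
    unfolding Q_def
  proof (rule MTP2_copula_VaR_mono[OF n \<open>prob_space \<mu>\<close> sets dens _ _ _ p1])
    show "density_slice n c p u * density_slice n c h u' \<le> density_slice n c p u' * density_slice n c h u"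
      if "u \<le> u'" for u u' using TP2[of h p u u'] h_le_p that by (simp add: w_def)
  qed (use K in auto)

  have pos_I: "I r h \<noteq> 0" if "enn2real (I r h / emeasure \<mu> (upper_box n h)) / (1 - p 1) \<noteq> 0" for r
    using that by auto
  have Ia0: "I a h \<noteq> 0" and Ib0: "I b h \<noteq> 0"
    using assms(19,20) ESX[of h] ESY[of h] pos_I by (auto simp: h_def[symmetric])
  have core: "I a p * I b h \<le> I b p * I a h"
    unfolding I_def
  proof (rule weighted_integral_ratio_le[OF _ _ _ _ _ E_sub E_AE a_mono b_mono a_pos b_pos a_fin b_fin bA])
    show "w' h u \<le> 1" if "u \<in> E" for u
      using w_le1[OF that h_pos] by (auto simp: w'_def split: split_indicator)
    show "w' h u \<le> w' h u'" if "u \<in> E" "u' \<in> E" "u \<le> u'" for u u'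
      using w_mono[OF that] that by (auto simp: w'_def split: split_indicator)
    \<comment> \<open>If the left side is nonzero then u exceeds \<open>Q p\<close>, hence also
      \<open>Q h\<close>, and so does \<open>u'\<close>; all four indicators are 1 and the
      inequality is that of the slices.\<close>
    show "w' p u * w' h u' \<le> w' p u' * w' h u" if "u \<in> E" "u' \<in> E" "u \<le> u'" for u u'
      using TP2[of h p u u'] h_le_p that Q_le by (auto simp: w'_def split: split_indicator)
    show "(\<integral>\<^sup>+u. ennreal (a u) * w' h u * indicator E u \<partial>lborel) \<noteq> 0" using Ia0 by (simp add: I_def)
  qed measurable

  have I_fin: "I r q < \<top>" if "q \<in> {p, h}" "(\<integral>\<^sup>+x. ennreal (r x) * indicator {0<..<1} x \<partial>lborel) < \<top>" for r q
  proof -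
    have le: "w' q u \<le> 1" if "u \<in> E" for u
    proof -
      have "0 < q j" if "j \<in> {2..n}" for j using lev[OF \<open>q \<in> {p, h}\<close>, of j] that by auto
      from w_le1[OF that this] show ?thesis by (auto simp: w'_def split: split_indicator)
    qed
    have "ennreal (r u) * w' q u \<le> ennreal (r u)" if "u \<in> E" for u
      using mult_left_mono[OF le[OF that], of "ennreal (r u)"] by simp
    then have "I r q \<le> (\<integral>\<^sup>+x. ennreal (r x) * indicator {0<..<1} x \<partial>lborel)"
      unfolding I_def using E_sub by (intro nn_integral_mono) (auto split: split_indicator)
    then show ?thesis using that(2) by simp
  qed

  \<comment> \<open>Back to real numbers\<close>
  define J where "J r q = enn2real (I r q)" for r q
  have J: "I a q = ennreal (J a q)" "I b q = ennreal (J b q)" if "q \<in> {p, h}" for q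
    using I_fin[OF that a_fin] I_fin[OF that b_fin] by (auto simp: J_def)
  have J0: "0 \<le> J r q" for r q by (simp add: J_def)
  have ESX': "MCoES n M X q = J a q / K q / (1 - p 1)" and ESY': "MCoES n N Y q = J b q / K q / (1 - p 1)"
    if "q \<in> {p, h}" for q
    using ESX[OF that] ESY[OF that] J[OF that] K[OF that] J0 by (auto simp: divide_ennreal)
  have Jpos: "0 < J a h" "0 < J b h"
    using Ia0 Ib0 J[of h] J0[of a h] J0[of b h] by (auto simp: order.order_iff_strict)
  have Jcore: "J a p * J b h \<le> J b p * J a h"
    using core J[of p] J[of h] J0 by (simp add: ennreal_mult[symmetric])
  have Kpos: "0 < K p" "0 < K h" using K by auto
  \<comment> \<open>Normalising by box probabilities and by \<open>1 - p 1\<close> leaves the factor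
    \<open>K h / K p\<close> and the summand -1, both common to the two vectors because the boxes
    are measured under one copula law.\<close>
  have Delta: "(x / K p / d - y / K h / d) / (y / K h / d) = x / y * (K h / K p) - 1"
    if "0 < y" "0 < d" for x y d :: real
    using that Kpos by (simp add: field_simps)
  have "J a p / J a h \<le> J b p / J b h"
    using Jcore Jpos by (simp add: field_simps)
  then have "J a p / J a h * (K h / K p) \<le> J b p / J b h * (K h / K p)"
    using Kpos by (intro mult_right_mono) auto
  moreover have "0 < 1 - p 1" using p1 by simp
  note Delta = Delta[OF Jpos(1) this] Delta[OF Jpos(2) this]
  ultimately show ?thesis
    unfolding Delta_R_med_MCoES_def h_def[symmetric]
    by (simp only: ESX' ESY' insertI1 insertI2 Delta diff_right_mono)
qed

end
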